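(* Let $k\geq 1$ be an integer and let $G$ be a finite simple undirected graph. The following conditions are equivalent: $(A_k)$ $G$ is a clique-sum of cliques (complete graphs) and graphs having treewidth $\leq k$. $(B_k)$ $G$ has a $k$-blended elimination ordering. $(3_k)$ $G$ has a $(k+1)$-clique chordal supergraph.
   Context: All graphs are finite, undirected and simple. Clique-sum: given graphs $G_1,G_2$ and cliques $K_p\subseteq G_1$, $K_p\subseteq G_2$, a graph obtained by bijectively identifying the vertices of these two cliques is a clique-sum of $G_1$ and $G_2$. $G$ is a clique-sum of $G_1,\dots,G_n$ if it can be formed by clique-sums among them (a single graph is a clique-sum of itself). Clique chordal supergraph: for an integer $m$, $G'$ is an $m$-clique chordal supergraph of $G$ if $V(G)=V(G')$, $E(G)\subseteq E(G')$, $G'$ is chordal, and $G'$ contains no $(m+1)$-cliques not contained by $G$. (Thus a $(k+1)$-clique chordal supergraph is one in which every clique on $k+2$ vertices is already a clique of $G$.) Fill-in graph: for an ordering $\pi=(v_1,\dots,v_{|V(G)|})$ of $V(G)$, the fill-in graph $G_\pi$ is constructed by starting with $G$ and, for $i=1,2,\dots,|V(G)|$ in turn, adding an edge between $v_j$ and $v_l$ for all distinct $j,l>i$ such that, in the current graph, $v_j$ and $v_l$ are both adjacent to $v_i$ and are not adjacent to each other. $N^+_\pi(v_i)$ is the set of higher-numbered neighbors of $v_i$ in $G_\pi$. $p$-blended elimination ordering (for a fixed integer $p$): an ordering $\pi$ of $V(G)$ such that for every $v_i$ either (i) $N^+_\pi(v_i)$ is complete in $G$, or (ii) $|N^+_\pi(v_i)|\le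 p$.
   Formalization: Condition (i) of a k-blended elimination ordering is corrected: v_i together with N^+(v_i), not only N^+(v_i), must be complete in G; with the original definition (B_k) does not imply (A_k) or (3_k) for any k ≥ 2 (take K_{k+2} with one edge subdivided). *)

theory Defs
  imports "Graph_Theory.Graph_Theory" "HOL-Library.Multiset"
begin

text \<open>
  Finite simple undirected graphs are represented by the locale \<^locale>\<open>pair_graph\<close> of the
  library: an undirected edge is a pair of opposite arcs. The graph without vertices is allowed.
  The empty set counts as a clique, so that the clique-sums below include disjoint unions
  (the case \<open>p = 0\<close>); without them the equivalence fails for disconnected graphs.
\<close>

definition clique :: "'a pair_pre_digraph \<Rightarrow> 'a set \<Rightarrow> bool" where
  "clique G K \<longleftrightarrow> K \<subseteq> pverts G \<and> (\<forall>u\<in>K. \<forall>v\<in>K. u \<noteq> v \<longrightarrow> (u, v) \<in> parcs G)"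

text \<open>
  The library notion of cycle is the directed one, for which \<open>a, b, a\<close> is a cycle of a symmetric
  digraph. Cycles of undirected graphs are given here by their list of distinct vertices. For the
  same reason the library notion of tree cannot be used for undirected graphs.
\<close>

definition graph_cycle :: "'a pair_pre_digraph \<Rightarrow> 'a list \<Rightarrow> bool" where
  "graph_cycle G c \<longleftrightarrow> length c \<ge> 3 \<and> distinct c \<and> set c \<subseteq> pverts G \<and>
     (\<forall>i<length c. (c ! i, c ! (Suc i mod length c)) \<in> parcs G)"

definition chordal :: "'a pair_pre_digraph \<Rightarrow> bool" where
  "chordal G \<longleftrightarrow> (\<forall>c. graph_cycle G c \<and> length c \<ge> 4 \<longrightarrow>
     (\<exists>i<length c. \<exists>j<length c. i \<noteq> j \<and> j \<noteq> Suc i mod length c \<and> i \<noteq> Suc j mod length c \<and>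
        (c ! i, c ! j) \<in> parcs G))"

definition undirected_tree :: "'a pair_pre_digraph \<Rightarrow> bool" where
  "undirected_tree T \<longleftrightarrow>
     pair_graph T \<and> Digraph_Component.connected (with_proj T) \<and> (\<nexists>c. graph_cycle T c)"

text \<open>
  Connectedness in the library includes nonemptiness, so the last conjunct below also says that
  every vertex lies in some bag.
\<close>

definition tree_decomposition ::
  "'a pair_pre_digraph \<Rightarrow> 'b pair_pre_digraph \<Rightarrow> ('b \<Rightarrow> 'a set) \<Rightarrow> bool" where
  "tree_decomposition G T B \<longleftrightarrow>
     undirected_tree T \<and>
     (\<forall>t\<in>pverts T. B t \<subseteq> pverts G) \<and>
     (\<forall>(u, v)\<in>parcs G. \<exists>t\<in>pverts T. u \<in> B t \<and> v \<in> B t) \<and>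
     (\<forall>v\<in>pverts G.
        Digraph_Component.connected (with_proj T \<restriction> {t \<in> pverts T. v \<in> B t}))"

text \<open>
  Natural number subtraction gives the graph without vertices treewidth 0 instead of -1. Every
  finite tree is isomorphic to one with natural numbers as nodes.
\<close>

definition decomposition_width :: "'b pair_pre_digraph \<Rightarrow> ('b \<Rightarrow> 'a set) \<Rightarrow> nat" where
  "decomposition_width T B = Max ((\<lambda>t. card (B t)) ` pverts T) - 1"

definition treewidth :: "'a pair_pre_digraph \<Rightarrow> nat" where
  "treewidth G = (LEAST w. \<exists>(T :: nat pair_pre_digraph) B.
     tree_decomposition G T B \<and> w = decomposition_width T B)"

text \<open>
  \<open>\<phi>\<close> is the bijection along which the cliques are identified; \<open>f1\<close> and \<open>f2\<close> are the embeddings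
  of the two graphs into the result of the identification, which thus is taken up to isomorphism.
  No edges are deleted.
\<close>

definition is_clique_sum ::
  "'b pair_pre_digraph \<Rightarrow> 'c pair_pre_digraph \<Rightarrow> 'a pair_pre_digraph \<Rightarrow> bool" where
  "is_clique_sum G1 G2 G \<longleftrightarrow> (\<exists>K1 K2 \<phi> f1 f2.
     clique G1 K1 \<and> clique G2 K2 \<and> bij_betw \<phi> K1 K2 \<and>
     inj_on f1 (pverts G1) \<and> inj_on f2 (pverts G2) \<and>
     (\<forall>x\<in>pverts G1. \<forall>y\<in>pverts G2. f1 x = f2 y \<longleftrightarrow> x \<in> K1 \<and> y = \<phi> x) \<and>
     pverts G = f1 ` pverts G1 \<union> f2 ` pverts G2 \<and>
     parcs G = map_prod f1 f1 ` parcs G1 \<union> map_prod f2 f2 ` parcs G2)"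

text \<open>
  \<open>clique_sum_of M G\<close>: \<open>G\<close> is formed from the graphs in the multiset \<open>M\<close> by clique-sums, each
  member being used once. Since all members embed into \<open>G\<close>, a single vertex type suffices.
\<close>

inductive clique_sum_of :: "'a pair_pre_digraph multiset \<Rightarrow> 'a pair_pre_digraph \<Rightarrow> bool" where
  single: "pair_graph G \<Longrightarrow> clique_sum_of {#G#} G"
| sum: "clique_sum_of M1 G1 \<Longrightarrow> clique_sum_of M2 G2 \<Longrightarrow> is_clique_sum G1 G2 G \<Longrightarrow>
    clique_sum_of (M1 + M2) G"

definition clique_chordal_supergraph ::
  "nat \<Rightarrow> 'a pair_pre_digraph \<Rightarrow> 'a pair_pre_digraph \<Rightarrow> bool" where
  "clique_chordal_supergraph m G G' \<longleftrightarrow>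
     pair_graph G' \<and> pverts G = pverts G' \<and> parcs G \<subseteq> parcs G' \<and> chordal G' \<and>
     (\<forall>K. clique G' K \<and> card K = m + 1 \<longrightarrow> clique G K)"

text \<open>
  Orderings of the vertices are lists, indexed from 0. All edges added in step \<open>i\<close> join vertices
  of index greater than \<open>i\<close>, so they can be added simultaneously.
\<close>

definition vertex_ordering :: "'a pair_pre_digraph \<Rightarrow> 'a list \<Rightarrow> bool" where
  "vertex_ordering G \<pi> \<longleftrightarrow> distinct \<pi> \<and> set \<pi> = pverts G"

definition fill_step :: "'a list \<Rightarrow> nat \<Rightarrow> 'a pair_pre_digraph \<Rightarrow> 'a pair_pre_digraph" where
  "fill_step \<pi> i H = \<lparr> pverts = pverts H,
     parcs = parcs H \<union> {(\<pi> ! j, \<pi> ! l) | j l.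
       i < j \<and> j < length \<pi> \<and> i < l \<and> l < length \<pi> \<and> j \<noteq> l \<and>
       (\<pi> ! j, \<pi> ! i) \<in> parcs H \<and> (\<pi> ! l, \<pi> ! i) \<in> parcs H} \<rparr>"

definition fill_in :: "'a pair_pre_digraph \<Rightarrow> 'a list \<Rightarrow> 'a pair_pre_digraph" where
  "fill_in G \<pi> = fold (fill_step \<pi>) [0..<length \<pi>] G"

definition higher_nbs :: "'a pair_pre_digraph \<Rightarrow> 'a list \<Rightarrow> nat \<Rightarrow> 'a set" where
  "higher_nbs G \<pi> i =
     {\<pi> ! j | j. i < j \<and> j < length \<pi> \<and> (\<pi> ! i, \<pi> ! j) \<in> parcs (fill_in G \<pi>)}"

text \<open>
  In the first alternative \<open>v\<^sub>i\<close> itself is included: \<open>v\<^sub>i\<close> together with its higher-numbered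
  neighbours is complete in \<open>G\<close>. It is not enough that the set of higher-numbered neighbours
  alone is complete in \<open>G\<close>, because the edges between \<open>v\<^sub>i\<close> and this set may be fill-in edges.
  For the complete graph on \<open>v, w, x, y\<close> with the edge between \<open>v\<close> and \<open>w\<close> subdivided by \<open>u\<close>,
  the ordering \<open>u, v, w, x, y\<close> would then be 2-blended, although that graph has treewidth 3, is
  not complete, and has no clique separator.
\<close>

definition blended_elimination_ordering :: "nat \<Rightarrow> 'a pair_pre_digraph \<Rightarrow> 'a list \<Rightarrow> bool" where
  "blended_elimination_ordering p G \<pi> \<longleftrightarrow> vertex_ordering G \<pi> \<and>
     (\<forall>i<length \<pi>. clique G (insert (\<pi> ! i) (higher_nbs G \<pi> i)) \<or> card (higher_nbs G \<pi> i) \<le> p)"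

end

theory Submission
  imports Defs
begin

text \<open>
  Everything goes through perfect elimination orderings. A vertex is simplicial if its neighbours
  form a clique, and a graph is chordal iff it can be emptied by repeatedly removing a simplicial
  vertex (\<open>chordal_iff_perfect_elim\<close>). By Dirac's argument any prescribed clique can be kept until
  the end (\<open>ex_simplicial_outside_clique\<close>, \<open>ex_perfect_elim_if_chordal\<close>).

  Blended orderings and chordal supergraphs. The fill-in graph \<open>G\<^sub>\<pi>\<close> is the least supergraph of \<open>G\<close>
  that has \<open>\<pi>\<close> as a perfect elimination ordering (\<open>perfect_elim_fill_in\<close>, \<open>fill_in_minimal\<close>). In a
  graph with such an ordering a vertex together with its later neighbours is a clique, and every
  clique is contained in the set that arises in this way from its first vertex. Hence a blended
  ordering forces every clique of \<open>G\<^sub>\<pi>\<close> with \<open>k + 2\<close> vertices to be a clique of \<open>G\<close>. Conversely, if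
  \<open>\<pi>\<close> eliminates a \<open>(k + 1)\<close>-clique chordal supergraph of \<open>G\<close>, a vertex with more than \<open>k\<close> later
  neighbours spans with them a set all of whose subsets with \<open>k + 2\<close> vertices are cliques of \<open>G\<close>,
  so the whole set is one.

  From clique-sums to chordal supergraphs. Supergraphs of two graphs can be glued along with the
  graphs: eliminate the second one so that the common clique is left, then the first one. No new
  cliques arise, since there are no edges between the two sides
  (\<open>clique_chordal_supergraph_clique_sum\<close>). A complete graph is its own supergraph. For a
  graph of treewidth at most \<open>k\<close>, make every bag of a tree decomposition complete. The tree has no
  cycles, so it is itself chordal, and a perfect elimination ordering of the tree removes a leaf in
  each step; the vertices which occur only in the bag of that leaf can be eliminated with it
  (\<open>perfect_elim_share_bag\<close>).

  From chordal supergraphs to clique-sums. If no clique of the supergraph \<open>G'\<close> has more than \<open>k + 1\<close>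
  vertices, then \<open>G\<close> has a tree decomposition whose bags are cliques of \<open>G'\<close>; it is built along a
  perfect elimination ordering (\<open>ex_clique_tree\<close>). Otherwise a largest clique \<open>K\<close> of \<open>G'\<close> is a
  clique of \<open>G\<close>. If it is not the whole graph, then \<open>G'\<close> has a proper separation along a subset of
  \<open>K\<close> (\<open>ex_separation_in_maximal_clique\<close>), this subset is a clique of \<open>G\<close>, and so \<open>G\<close> is the
  clique-sum of the two smaller sides, to which induction applies.
\<close>

section \<open>Cliques and induced subgraphs\<close>

abbreviation complete_on :: "'a rel \<Rightarrow> 'a set \<Rightarrow> bool" where
  "complete_on E K \<equiv> pairwise (\<lambda>u v. (u, v) \<in> E) K"

lemma complete_on_mono: "complete_on E K \<Longrightarrow> E \<subseteq> E' \<Longrightarrow> L \<subseteq> K \<Longrightarrow> complete_on E' L"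
  by (auto simp: pairwise_def)

lemma clique_iff: "clique G K \<longleftrightarrow> K \<subseteq> pverts G \<and> complete_on (parcs G) K"
  by (simp add: clique_def pairwise_def)

lemma clique_subset: "clique G L \<Longrightarrow> K \<subseteq> L \<Longrightarrow> clique G K"
  by (auto simp: clique_def)

lemma clique_image:
  assumes "clique G Q" "f ` pverts G \<subseteq> pverts H" "map_prod f f ` parcs G \<subseteq> parcs H"
  shows "clique H (f ` Q)"
  unfolding clique_def
proof (intro conjI ballI impI)
  show "f ` Q \<subseteq> pverts H" using assms(1,2) by (auto simp: clique_def)
  fix u v assume "u \<in> f ` Q" "v \<in> f ` Q" "u \<noteq> v"
  then obtain x y where xy: "u = f x" "v = f y" "x \<in> Q" "y \<in> Q" by (elim imageE)
  moreover have "x \<noteq> y" using xy(1,2) \<open>u \<noteq> v\<close> by auto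
  ultimately have "(x, y) \<in> parcs G" using assms(1) by (simp add: clique_def)
  then have "(f x, f y) \<in> map_prod f f ` parcs G" by (rule map_prod_imageI[of x y _ f f])
  then show "(u, v) \<in> parcs H" unfolding xy(1,2) by (rule subsetD[OF assms(3)])
qed

text \<open>
  Any vertex and any pair of vertices of \<open>L\<close> extends to a subset with \<open>n\<close> elements. This is how a
  condition on cliques of one size controls all larger ones.
\<close>

lemma clique_if_small_subsets_cliques:
  assumes "\<And>K. K \<subseteq> L \<Longrightarrow> card K = n \<Longrightarrow> clique G K" "n \<ge> 2" "card L \<ge> n"
  shows "clique G L"
  unfolding clique_def
proof (intro conjI ballI impI)
  have fin: "finite L"
    by (rule ccontr) (use assms(2,3) in simp)
  have ext: "\<exists>K. S \<subseteq> K \<and> K \<subseteq> L \<and> card K = n" if "S \<subseteq> L" "card S \<le> n" for S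
    using exists_subset_between[OF that(2) assms(3) that(1) fin] by blast
  show "L \<subseteq> pverts G"
  proof
    fix x assume "x \<in> L"
    then obtain K where "{x} \<subseteq> K" "clique G K"
      using ext[of "{x}"] assms(1,2) by auto
    then show "x \<in> pverts G" by (auto simp: clique_def)
  qed
  fix x y assume "x \<in> L" "y \<in> L" "x \<noteq> y"
  then obtain K where "{x, y} \<subseteq> K" "clique G K"
    using ext[of "{x, y}"] assms(1,2) by auto
  then show "(x, y) \<in> parcs G" using \<open>x \<noteq> y\<close> by (auto simp: clique_def)
qed

lemma pair_graph_iff:
  "pair_graph G \<longleftrightarrow> finite (pverts G) \<and> parcs G \<subseteq> pverts G \<times> pverts G \<and>
     sym (parcs G) \<and> irrefl (parcs G)"
proof
  assume "pair_graph G"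
  then interpret pair_graph G .
  show "finite (pverts G) \<and> parcs G \<subseteq> pverts G \<times> pverts G \<and> sym (parcs G) \<and> irrefl (parcs G)"
    using pair_finite_verts wellformed' arcs_symmetric no_loops'
    by (fastforce simp: sym_def irrefl_def)
next
  assume *: "finite (pverts G) \<and> parcs G \<subseteq> pverts G \<times> pverts G \<and>
    sym (parcs G) \<and> irrefl (parcs G)"
  then have "finite (parcs G)"
    by (meson finite_SigmaI finite_subset)
  with * show "pair_graph G"
    by unfold_locales (auto simp: irrefl_def symmetric_def)
qed

lemma pair_graphD:
  assumes "pair_graph G"
  shows "finite (pverts G)" "parcs G \<subseteq> pverts G \<times> pverts G" "sym (parcs G)" "irrefl (parcs G)"
    "(u, v) \<in> parcs G \<Longrightarrow> u \<in> pverts G" "(u, v) \<in> parcs G \<Longrightarrow> v \<in> pverts G"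
    "(u, v) \<in> parcs G \<Longrightarrow> (v, u) \<in> parcs G" "(u, u) \<notin> parcs G"
  using assms by (auto simp: pair_graph_iff sym_def irrefl_def)

definition induced :: "'a pair_pre_digraph \<Rightarrow> 'a set \<Rightarrow> 'a pair_pre_digraph" where
  "induced G A = \<lparr> pverts = A, parcs = parcs G \<inter> A \<times> A \<rparr>"

lemma induced_simps [simp]:
  "pverts (induced G A) = A" "parcs (induced G A) = parcs G \<inter> A \<times> A"
  by (simp_all add: induced_def)

lemma pair_graph_induced: "pair_graph G \<Longrightarrow> A \<subseteq> pverts G \<Longrightarrow> pair_graph (induced G A)"
  by (auto simp: pair_graph_iff sym_def irrefl_def intro: finite_subset)

lemma chordal_chord:
  assumes "chordal G" "graph_cycle G c" "length c \<ge> 4"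
  obtains i j where "i < length c" "j < length c" "i \<noteq> j" "j \<noteq> Suc i mod length c"
    "i \<noteq> Suc j mod length c" "(c ! i, c ! j) \<in> parcs G"
  using assms unfolding chordal_def by blast

lemma chordal_induced:
  assumes "chordal G" "A \<subseteq> pverts G"
  shows "chordal (induced G A)"
  unfolding chordal_def
proof (intro allI impI)
  fix c assume c: "graph_cycle (induced G A) c \<and> 4 \<le> length c"
  then have "graph_cycle G c"
    using assms(2) by (auto simp: graph_cycle_def)
  then obtain i j where ij: "i < length c" "j < length c" "i \<noteq> j" "j \<noteq> Suc i mod length c"
      "i \<noteq> Suc j mod length c" "(c ! i, c ! j) \<in> parcs G"
    using assms(1) c unfolding chordal_def by blast
  moreover have "c ! i \<in> A" "c ! j \<in> A"
    using c ij(1,2) nth_mem by (fastforce simp: graph_cycle_def)+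
  ultimately show "\<exists>i<length c. \<exists>j<length c. i \<noteq> j \<and> j \<noteq> Suc i mod length c \<and>
      i \<noteq> Suc j mod length c \<and> (c ! i, c ! j) \<in> parcs (induced G A)"
    by auto
qed

section \<open>Simplicial vertices of chordal graphs\<close>

definition path_in :: "'a rel \<Rightarrow> 'a set \<Rightarrow> 'a list \<Rightarrow> 'a \<Rightarrow> 'a \<Rightarrow> bool" where
  "path_in E F xs x y \<longleftrightarrow> xs \<noteq> [] \<and> hd xs = x \<and> last xs = y \<and> set xs \<subseteq> F \<and>
     successively (\<lambda>u v. (u, v) \<in> E) xs"

lemma rtrancl_on_imp_path_in:
  assumes "(x, y) \<in> rtrancl_on F E"
  shows "\<exists>xs. path_in E F xs x y"
  using assms
proof (induction rule: rtrancl_on_induct)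
  case base
  then have "path_in E F [x] x x" by (simp add: path_in_def)
  then show ?case ..
next
  case (step y z)
  then obtain xs where "path_in E F xs x y" by blast
  with step have "path_in E F (xs @ [z]) x z"
    by (auto simp: path_in_def successively_append_iff)
  then show ?case ..
qed

text \<open>
  A chord \<open>(xs ! i, xs ! j)\<close> replaces the piece of the path between its ends. The path gets shorter
  if \<open>j > i + 1\<close>, hence a shortest path has no chords.
\<close>

lemma path_in_shortcut:
  assumes "path_in E F xs x y" "i < length xs" "j < length xs" "(xs ! i, xs ! j) \<in> E"
  shows "path_in E F (take (Suc i) xs @ drop j xs) x y"
proof -
  have "successively (\<lambda>u v. (u, v) \<in> E) (take (Suc i) xs @ drop (Suc i) xs)"
    "successively (\<lambda>u v. (u, v) \<in> E) (take j xs @ drop j xs)"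
    using assms(1) by (simp_all add: path_in_def)
  then have "successively (\<lambda>u v. (u, v) \<in> E) (take (Suc i) xs)"
    "successively (\<lambda>u v. (u, v) \<in> E) (drop j xs)"
    unfolding successively_append_iff by blast+
  moreover have "last (take (Suc i) xs) = xs ! i"
    using assms(2) by (simp add: take_Suc_conv_app_nth)
  moreover have "hd (take (Suc i) xs) = hd xs"
    using assms(1) by (simp add: path_in_def)
  ultimately show ?thesis
    using assms by (auto simp: path_in_def successively_append_iff hd_drop_conv_nth
      dest!: in_set_takeD in_set_dropD)
qed

lemma path_in_cut_loop:
  assumes "path_in E F xs x y" "i < j" "j < length xs" "xs ! i = xs ! j"
  shows "path_in E F (take i xs @ drop j xs) x y"
proof (cases i)
  case 0
  have "successively (\<lambda>u v. (u, v) \<in> E) (take j xs @ drop j xs)"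
    using assms(1) by (simp add: path_in_def)
  then have "successively (\<lambda>u v. (u, v) \<in> E) (drop j xs)"
    unfolding successively_append_iff by blast
  then show ?thesis
    using assms 0 by (auto simp: path_in_def hd_drop_conv_nth hd_conv_nth dest: in_set_dropD)
next
  case (Suc k)
  have "(xs ! k, xs ! Suc k) \<in> E"
    using assms(1-3) Suc by (simp add: path_in_def successively_conv_nth)
  then show ?thesis
    using path_in_shortcut[OF assms(1), of k j] assms Suc by simp
qed

lemma rtrancl_on_imp_induced_path:
  assumes "(x, y) \<in> rtrancl_on F E"
  shows "\<exists>xs. path_in E F xs x y \<and> distinct xs \<and>
    (\<forall>i j. i < j \<longrightarrow> j < length xs \<longrightarrow> (xs ! i, xs ! j) \<in> E \<longrightarrow> j = Suc i)"
proof -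
  obtain xs where xs: "path_in E F xs x y"
    and min: "\<And>ys. path_in E F ys x y \<Longrightarrow> length xs \<le> length ys"
    using ex_has_least_nat[of "\<lambda>xs. path_in E F xs x y" _ length]
      rtrancl_on_imp_path_in[OF assms] by blast
  have "distinct xs"
    unfolding distinct_conv_nth
  proof (intro allI impI)
    fix i j assume "i < length xs" "j < length xs" "i \<noteq> j"
    moreover have False if "i < j" "j < length xs" "xs ! i = xs ! j" for i j
      using min[OF path_in_cut_loop[OF xs that]] that by simp
    ultimately show "xs ! i \<noteq> xs ! j"
      by (metis linorder_neq_iff)
  qed
  moreover have "j = Suc i" if "i < j" "j < length xs" "(xs ! i, xs ! j) \<in> E" for i j
    using min[OF path_in_shortcut[OF xs _ that(2,3)]] that by simp
  ultimately show ?thesis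
    using xs by blast
qed

text \<open>
  The set in question consists of the neighbours of \<open>v\<close> on the boundary of the connected set \<open>C\<close>. If
  two of them, \<open>x\<close> and \<open>y\<close>, were not adjacent, a shortest path between them through \<open>C\<close> would have
  at least three vertices and no chord. Together with \<open>v\<close>, which has no neighbour in \<open>C\<close>, it would
  form a chordless cycle of length at least 4.
\<close>

lemma minimal_separator_complete:
  assumes G: "pair_graph G" and ch: "chordal G"
    and vC: "v \<notin> C" "\<forall>c\<in>C. (v, c) \<notin> parcs G"
    and conn: "\<forall>c\<in>C. \<forall>d\<in>C. (c, d) \<in> rtrancl_on C (parcs G)"
  shows "complete_on (parcs G) {s. (v, s) \<in> parcs G \<and> (\<exists>c\<in>C. (c, s) \<in> parcs G)}"
proof (rule pairwiseI, rule ccontr)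
  let ?E = "parcs G"
  note g = pair_graphD[OF G]
  fix x y
  assume x: "x \<in> {s. (v, s) \<in> ?E \<and> (\<exists>c\<in>C. (c, s) \<in> ?E)}"
    and y: "y \<in> {s. (v, s) \<in> ?E \<and> (\<exists>c\<in>C. (c, s) \<in> ?E)}" and "x \<noteq> y" and xy: "(x, y) \<notin> ?E"
  let ?F = "insert x (insert y C)"
  obtain c d where cd: "c \<in> C" "d \<in> C" "(c, x) \<in> ?E" "(d, y) \<in> ?E"
    using x y by auto
  have "(c, d) \<in> rtrancl_on ?F ?E"
    using conn cd by (meson rtrancl_on_mono subset_insertI2 subset_refl subset_insertI)
  then have "(c, y) \<in> rtrancl_on ?F ?E"
    using cd by (auto intro: rtrancl_on_into_rtrancl_on)
  then have "(x, y) \<in> rtrancl_on ?F ?E"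
    using cd g(7) by (auto intro: converse_rtrancl_on_into_rtrancl_on)
  then obtain p where p: "path_in ?E ?F p x y" "distinct p"
    and ind: "\<And>i j. i < j \<Longrightarrow> j < length p \<Longrightarrow> (p ! i, p ! j) \<in> ?E \<Longrightarrow> j = Suc i"
    using rtrancl_on_imp_induced_path by metis
  have pne: "p \<noteq> []" and p0: "p ! 0 = x" and plast: "p ! (length p - 1) = y"
    and pset: "set p \<subseteq> ?F"
    using p(1) by (auto simp: path_in_def hd_conv_nth last_conv_nth)
  have padj: "(p ! i, p ! Suc i) \<in> ?E" if "Suc i < length p" for i
    using p(1) that by (simp add: path_in_def successively_conv_nth)
  have len: "length p \<ge> 3"
  proof (rule ccontr)
    assume "\<not> length p \<ge> 3"
    then have "length p = 1 \<or> length p = 2"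
      using length_greater_0_conv[of p] pne by linarith
    then show False
      using p0 plast padj[of 0] xy \<open>x \<noteq> y\<close> by (auto simp: numeral_2_eq_2)
  qed
  let ?c = "v # p"
  have vx: "(v, x) \<in> ?E" "(v, y) \<in> ?E" using x y by auto
  have "v \<notin> set p"
    using pset vC(1) vx g(8) by auto
  have "graph_cycle G ?c"
    unfolding graph_cycle_def
  proof (intro conjI allI impI)
    show "3 \<le> length ?c" using len by simp
    show "distinct ?c" using p(2) \<open>v \<notin> set p\<close> by simp
    have "u \<in> pverts G" if "u \<in> C" for u
    proof -
      have "(u, c) \<in> rtrancl_on C ?E" using conn that cd by blast
      then show ?thesis
        using cd g(5) by (cases rule: converse_rtrancl_on_cases) auto
    qed
    then show "set ?c \<subseteq> pverts G"
      using pset vx g(5,6) by auto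
    fix i assume i: "i < length ?c"
    consider "i = 0" | "i = length p" "i \<noteq> 0" | "i \<noteq> 0" "i < length p"
      using i by fastforce
    then show "(?c ! i, ?c ! (Suc i mod length ?c)) \<in> ?E"
    proof cases
      case 1
      then show ?thesis using p0 vx pne by simp
    next
      case 2
      then show ?thesis using plast vx g(7) by simp
    next
      case 3
      then show ?thesis using padj[of "i - 1"] by simp
    qed
  qed
  moreover have "length ?c \<ge> 4" using len by simp
  ultimately obtain i j where "i < length ?c" "j < length ?c" "i \<noteq> j" "j \<noteq> Suc i mod length ?c"
      "i \<noteq> Suc j mod length ?c" "(?c ! i, ?c ! j) \<in> ?E"
    by (rule chordal_chord[OF ch])
  moreover have False if "i < j" "j < length ?c" "j \<noteq> Suc i mod length ?c"
      "i \<noteq> Suc j mod length ?c" "(?c ! i, ?c ! j) \<in> ?E" for i j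
  proof (cases "i = 0")
    \<comment> \<open>The chord would start at \<open>v\<close>. Of the path, only the ends are adjacent to \<open>v\<close>, and these are
      the neighbours of \<open>v\<close> on the cycle.\<close>
    case True
    with that have j: "0 < j" "j \<le> length p" "(v, p ! (j - 1)) \<in> ?E"
      by auto
    then have "p ! (j - 1) \<in> set p" by simp
    then have "p ! (j - 1) \<in> ?F" using pset by blast
    then have "p ! (j - 1) = p ! 0 \<or> p ! (j - 1) = p ! (length p - 1)"
      using vC(2) j(3) unfolding p0 plast by blast
    then have "j - 1 = 0 \<or> j - 1 = length p - 1"
      using p(2) j pne by (auto simp: nth_eq_iff_index_eq)
    then show False
    proof
      assume "j - 1 = 0"
      then have "j = 1" using j by simp
      then show False using that True pne by simp
    next
      assume "j - 1 = length p - 1"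
      then have "j = length p" using j by simp
      then show False using that True by simp
    qed
  next
    \<comment> \<open>Both ends lie on the path, which has no chords.\<close>
    case False
    then have "(p ! (i - 1), p ! (j - 1)) \<in> ?E" "i - 1 < j - 1" "j - 1 < length p"
      using that by auto
    then have "j - 1 = Suc (i - 1)" using ind by blast
    then show False using that False by simp
  qed
  ultimately show False
    using g(7)[of "?c ! i" "?c ! j"] by (cases i j rule: linorder_cases) blast+
qed

text \<open>
  A form of Dirac's theorem that supports induction. Choose a vertex \<open>v\<close> that is not adjacent to all
  others and whose closed neighbourhood contains \<open>K\<close>: a vertex of \<open>K\<close> if possible; otherwise all
  vertices of \<open>K\<close> are adjacent to everything, and any other vertex will do. Let \<open>C\<close> be a component of
  the graph without the closed neighbourhood of \<open>v\<close>, and \<open>S\<close> the set of neighbours of \<open>C\<close> outside of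
  \<open>C\<close>. Then \<open>S\<close> is a clique, and in the graph induced by \<open>C \<union> S\<close>, which lacks \<open>v\<close>, the induction
  hypothesis gives a simplicial vertex outside of \<open>S\<close>. As it lies in \<open>C\<close>, it has no further
  neighbours in the whole graph.
\<close>

lemma ex_simplicial_outside_clique:
  assumes "pair_graph G" "chordal G" "clique G K" "K \<noteq> pverts G"
  shows "\<exists>v\<in>pverts G - K. complete_on (parcs G) {u. (v, u) \<in> parcs G}"
  using assms
proof (induction "card (pverts G)" arbitrary: G K rule: less_induct)
  case less
  let ?E = "parcs G" and ?V = "pverts G"
  note g = pair_graphD[OF less.prems(1)]
  have K: "K \<subseteq> ?V" "complete_on ?E K" using less.prems(3) by (auto simp: clique_iff)
  show ?case
  proof (cases "complete_on ?E ?V")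
    case True
    obtain v where "v \<in> ?V - K" using K less.prems(4) by blast
    moreover have "complete_on ?E {u. (v, u) \<in> ?E}"
      using True by (rule complete_on_mono) (use g(6) in auto)
    ultimately show ?thesis by blast
  next
    case False
    obtain v w where v: "v \<in> ?V" "w \<in> ?V" "w \<noteq> v" "(v, w) \<notin> ?E"
      and Kv: "K \<subseteq> insert v {u. (v, u) \<in> ?E}"
    proof (cases "\<exists>v\<in>K. \<exists>w\<in>?V. w \<noteq> v \<and> (v, w) \<notin> ?E")
      case True
      then obtain v w where "v \<in> K" "w \<in> ?V" "w \<noteq> v" "(v, w) \<notin> ?E" by blast
      moreover have "K \<subseteq> insert v {u. (v, u) \<in> ?E}"
        using K(2) \<open>v \<in> K\<close> by (auto simp: pairwise_def)
      moreover have "v \<in> ?V" using K(1) \<open>v \<in> K\<close> by blast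
      ultimately show ?thesis using that by metis
    next
      case univ: False
      obtain v w where "v \<in> ?V" "w \<in> ?V" "w \<noteq> v" "(v, w) \<notin> ?E"
        using False unfolding pairwise_def by blast
      then show ?thesis
      proof (rule that)
        show "K \<subseteq> insert v {u. (v, u) \<in> ?E}"
        proof
          fix x assume "x \<in> K"
          then have "x \<noteq> v \<longrightarrow> (x, v) \<in> ?E" using univ \<open>v \<in> ?V\<close> by auto
          then show "x \<in> insert v {u. (v, u) \<in> ?E}" using g(7)[of x v] by auto
        qed
      qed
    qed
    define R where "R = {u \<in> ?V. u \<noteq> v \<and> (v, u) \<notin> ?E}"
    define C where "C = {u. (w, u) \<in> rtrancl_on R ?E}"
    define S where "S = {s. (v, s) \<in> ?E \<and> (\<exists>c\<in>C. (c, s) \<in> ?E)}"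
    have "w \<in> C" using v by (simp add: C_def R_def)
    have CR: "C \<subseteq> R" by (auto simp: C_def dest: in_rtrancl_on_in_F)
    \<comment> \<open>The vertices on a path from \<open>w\<close> in \<open>R\<close> are reached from \<open>w\<close> as well, so the path stays
      in \<open>C\<close>.\<close>
    have conn1: "(w, u) \<in> rtrancl_on C ?E" if "u \<in> C" for u
    proof -
      from that have "(w, u) \<in> rtrancl_on R ?E" by (simp add: C_def)
      then show ?thesis
      proof (induction rule: rtrancl_on_induct)
        case base
        then show ?case using \<open>w \<in> C\<close> by simp
      next
        case (step y z)
        then show ?case
          by (metis (mono_tags, lifting) C_def mem_Collect_eq
              rtrancl_on_into_rtrancl_on)
      qed
    qed
    have conn: "\<forall>c\<in>C. \<forall>d\<in>C. (c, d) \<in> rtrancl_on C ?E"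
      using conn1 rtrancl_on_sym[OF g(3)] by (meson rtrancl_on_trans symD)
    have Sc: "complete_on ?E S"
      unfolding S_def
      by (rule minimal_separator_complete[OF less.prems(1,2) _ _ conn])
        (use CR in \<open>auto simp: R_def\<close>)
    have closed: "x \<in> C \<union> S" if "u \<in> C" "(u, x) \<in> ?E" for u x
    proof (cases "(v, x) \<in> ?E")
      case True
      then show ?thesis using that by (auto simp: S_def)
    next
      case False
      have "x \<in> R"
        using that False CR g(6,7) by (auto simp: R_def)
      then have "x \<in> C"
        using that by (auto simp: C_def intro: rtrancl_on_into_rtrancl_on)
      then show ?thesis ..
    qed
    let ?H = "induced G (C \<union> S)"
    have sub: "C \<union> S \<subseteq> ?V" using CR g(6) by (auto simp: R_def S_def)
    have "v \<notin> C \<union> S" using CR g(8) by (auto simp: R_def S_def)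
    then have "card (pverts ?H) < card ?V"
      using sub g(1) v(1) by (auto intro!: psubset_card_mono)
    moreover have "clique ?H S"
      using Sc by (auto simp: clique_iff pairwise_def)
    moreover have "S \<noteq> pverts ?H"
      using \<open>w \<in> C\<close> CR by (auto simp: R_def S_def)
    ultimately obtain u where u: "u \<in> C \<union> S - S"
        "complete_on (parcs ?H) {x. (u, x) \<in> parcs ?H}"
      using less.hyps[of ?H S] pair_graph_induced[OF less.prems(1) sub]
        chordal_induced[OF less.prems(2) sub] by auto
    have "complete_on ?E {x. (u, x) \<in> ?E}"
      using u(2) by (rule complete_on_mono) (use u(1) closed in auto)
    moreover have "u \<in> ?V - K"
      using u(1) CR Kv by (auto simp: R_def)
    ultimately show ?thesis by blast
  qed
qed

section \<open>Perfect elimination orderings\<close>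

text \<open>
  The vertices of \<open>K\<close> remain when all vertices of the list have been eliminated. For \<open>K = {}\<close> these
  are the usual perfect elimination orderings; the general case is needed to concatenate them.
\<close>

fun perfect_elim :: "'a rel \<Rightarrow> 'a set \<Rightarrow> 'a list \<Rightarrow> bool" where
  "perfect_elim E K [] \<longleftrightarrow> True"
| "perfect_elim E K (v # vs) \<longleftrightarrow>
     complete_on E {x \<in> set vs \<union> K. (v, x) \<in> E} \<and> perfect_elim E K vs"

lemma perfect_elim_append:
  "perfect_elim E K (us @ vs) \<longleftrightarrow> perfect_elim E (set vs \<union> K) us \<and> perfect_elim E K vs"
  by (induction us) (auto simp: Un_assoc)

text \<open>
  The elimination condition concerns only edges from an eliminated vertex to later vertices and
  edges among these, so both the graph and the remaining set may change elsewhere.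
\<close>

lemma perfect_elim_transfer:
  assumes "perfect_elim E K vs"
    and "\<And>v x. v \<in> set vs \<Longrightarrow> x \<in> set vs \<union> K' \<Longrightarrow> (v, x) \<in> E' \<Longrightarrow> (v, x) \<in> E \<and> (x \<in> K' \<longrightarrow> x \<in> K)"
    and "\<And>x y. x \<in> set vs \<union> K \<Longrightarrow> y \<in> set vs \<union> K \<Longrightarrow> (x, y) \<in> E \<Longrightarrow> (x, y) \<in> E'"
  shows "perfect_elim E' K' vs"
  using assms
proof (induction vs)
  case (Cons v vs)
  have "perfect_elim E' K' vs"
    using Cons.prems by (intro Cons.IH) auto
  moreover have "{x \<in> set vs \<union> K'. (v, x) \<in> E'} \<subseteq> {x \<in> set vs \<union> K. (v, x) \<in> E}"
    using Cons.prems(2)[of v] by auto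
  moreover have "complete_on E' {x \<in> set vs \<union> K. (v, x) \<in> E}"
    using Cons.prems(1,3) by (auto simp: pairwise_def)
  ultimately show ?case
    by (simp add: pairwise_subset)
qed simp

lemma perfect_elim_map:
  assumes "perfect_elim E K vs" "inj_on f (set vs \<union> K)"
    and "E \<subseteq> (set vs \<union> K) \<times> (set vs \<union> K)"
  shows "perfect_elim (map_prod f f ` E) (f ` K) (map f vs)"
proof -
  have edge: "(f x, f y) \<in> map_prod f f ` E \<longleftrightarrow> (x, y) \<in> E"
    if xy: "x \<in> set vs \<union> K" "y \<in> set vs \<union> K" for x y
  proof
    assume "(f x, f y) \<in> map_prod f f ` E"
    then obtain a b where ab: "(a, b) \<in> E" "f x = f a" "f y = f b" by auto
    then have mem: "a \<in> set vs \<union> K" "b \<in> set vs \<union> K" using assms(3) by auto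
    have "x = a" "y = b"
      using inj_onD[OF assms(2) ab(2) xy(1) mem(1)] inj_onD[OF assms(2) ab(3) xy(2) mem(2)] .
    then show "(x, y) \<in> E" using ab(1) by (simp only:)
  next
    assume "(x, y) \<in> E"
    then show "(f x, f y) \<in> map_prod f f ` E"
      by (rule map_prod_imageI[of x y E f f])
  qed
  have "perfect_elim (map_prod f f ` E) (f ` K) (map f ws)"
    if "perfect_elim E K ws" "set ws \<subseteq> set vs" for ws
    using that
  proof (induction ws)
    case (Cons w ws)
    have "complete_on (map_prod f f ` E) {x \<in> f ` (set ws \<union> K). (f w, x) \<in> map_prod f f ` E}"
    proof (rule pairwiseI)
      fix x' y'
      assume x': "x' \<in> {x \<in> f ` (set ws \<union> K). (f w, x) \<in> map_prod f f ` E}"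
        and y': "y' \<in> {x \<in> f ` (set ws \<union> K). (f w, x) \<in> map_prod f f ` E}" and "x' \<noteq> y'"
      obtain x y where xy: "x' = f x" "y' = f y" "x \<in> set ws \<union> K" "y \<in> set ws \<union> K"
        using x' y' by blast
      have "(f w, x') \<in> map_prod f f ` E" "(f w, y') \<in> map_prod f f ` E"
        using x' y' by (simp_all only: mem_Collect_eq)
      note * = xy(3,4) this[unfolded xy(1,2)]
      have mem: "w \<in> set vs \<union> K" "x \<in> set vs \<union> K" "y \<in> set vs \<union> K"
        using xy(3,4) Cons.prems(2) by auto
      have "(w, x) \<in> E" "(w, y) \<in> E"
        using iffD1[OF edge[OF mem(1,2)] *(3)] iffD1[OF edge[OF mem(1,3)] *(4)] .
      then have "(x, y) \<in> E"
        using xy Cons.prems(1) \<open>x' \<noteq> y'\<close> by (auto simp: pairwise_def)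
      then show "(x', y') \<in> map_prod f f ` E"
        unfolding xy by (rule map_prod_imageI[of x y E f f])
    qed
    then show ?case
      using Cons by (simp add: image_Un)
  qed simp
  then show ?thesis using assms(1) by simp
qed

lemma perfect_elim_nth:
  assumes "perfect_elim E K vs" "i < j" "i < l" "j < length vs" "l < length vs" "vs ! j \<noteq> vs ! l"
    "(vs ! i, vs ! j) \<in> E" "(vs ! i, vs ! l) \<in> E"
  shows "(vs ! j, vs ! l) \<in> E"
  using assms
proof (induction vs arbitrary: i j l)
  case (Cons v vs)
  obtain j' l' where jl: "j = Suc j'" "l = Suc l'"
    using Cons.prems(2,3) by (cases j; cases l) simp_all
  show ?case
  proof (cases i)
    case 0
    then show ?thesis
      using Cons.prems jl by (auto simp: pairwise_def)
  next
    case (Suc i')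
    then show ?thesis
      using Cons.prems jl Cons.IH[of i' j' l'] by simp
  qed
qed simp

lemma perfect_elimI_nth:
  assumes "\<And>i j l. i < j \<Longrightarrow> i < l \<Longrightarrow> j < length vs \<Longrightarrow> l < length vs \<Longrightarrow> j \<noteq> l \<Longrightarrow>
    (vs ! i, vs ! j) \<in> E \<Longrightarrow> (vs ! i, vs ! l) \<in> E \<Longrightarrow> (vs ! j, vs ! l) \<in> E"
  shows "perfect_elim E {} vs"
  using assms
proof (induction vs)
  case (Cons v vs)
  have "perfect_elim E {} vs"
    using Cons.prems[of "Suc _" "Suc _" "Suc _"] by (intro Cons.IH) simp
  moreover have "complete_on E {x \<in> set vs. (v, x) \<in> E}"
    unfolding pairwise_def
  proof safe
    fix x y assume *: "x \<in> set vs" "(v, x) \<in> E" "y \<in> set vs" "(v, y) \<in> E" "x \<noteq> y"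
    then obtain j l where "j < length vs" "x = vs ! j" "l < length vs" "y = vs ! l"
      by (auto simp: in_set_conv_nth)
    then show "(x, y) \<in> E"
      using Cons.prems[of 0 "Suc j" "Suc l"] * by auto
  qed
  ultimately show ?case by simp
qed simp

text \<open>
  The vertex of \<open>S\<close> that is eliminated first works.
\<close>

lemma perfect_elim_ex_simplicial:
  assumes "perfect_elim E {} vs" "irrefl E" "S \<subseteq> set vs" "S \<noteq> {}"
  shows "\<exists>v\<in>S. complete_on E {x \<in> S. (v, x) \<in> E}"
  using assms
proof (induction vs)
  case (Cons v vs)
  show ?case
  proof (cases "v \<in> S")
    case True
    have "{x \<in> S. (v, x) \<in> E} \<subseteq> {x \<in> set vs. (v, x) \<in> E}"
      using Cons.prems by (auto simp: irrefl_def)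
    then have "complete_on E {x \<in> S. (v, x) \<in> E}"
      using Cons.prems(1) pairwise_subset by auto
    then show ?thesis using True by blast
  next
    case False
    then show ?thesis using Cons by (auto simp: subset_insert)
  qed
qed simp

text \<open>
  The two neighbours on a cycle of the vertex that is eliminated first are adjacent, which is a
  chord if the cycle has length at least 4.
\<close>

lemma chordal_if_perfect_elim:
  assumes G: "pair_graph G" and vs: "set vs = pverts G" "perfect_elim (parcs G) {} vs"
  shows "chordal G"
  unfolding chordal_def
proof (intro allI impI)
  fix c assume c: "graph_cycle G c \<and> 4 \<le> length c"
  let ?n = "length c" and ?E = "parcs G"
  note g = pair_graphD[OF G]
  have dist: "distinct c" and adj: "\<And>i. i < ?n \<Longrightarrow> (c ! i, c ! (Suc i mod ?n)) \<in> ?E"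
    and n: "?n \<ge> 4" and sub: "set c \<subseteq> set vs"
    using c vs(1) by (auto simp: graph_cycle_def)
  have "c \<noteq> []" using n by auto
  then have "set c \<noteq> {}" by simp
  then obtain v where v: "v \<in> set c" "complete_on ?E {x \<in> set c. (v, x) \<in> ?E}"
    using perfect_elim_ex_simplicial[OF vs(2) g(4) sub] by blast
  then obtain i where i: "i < ?n" "v = c ! i" by (metis in_set_conv_nth)
  \<comment> \<open>the positions before and after \<open>i\<close> on the cycle\<close>
  define a where "a = (if i = 0 then ?n - 1 else i - 1)"
  define b where "b = (if i = ?n - 1 then 0 else Suc i)"
  have b: "b = Suc i mod ?n" "b < ?n" and a: "a < ?n" "Suc a mod ?n = i"
    using i n \<open>c \<noteq> []\<close> by (auto simp: a_def b_def)
  have ab: "a \<noteq> b" "b \<noteq> i" "a \<noteq> Suc b mod ?n"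
    using i n by (auto simp: a_def b_def mod_Suc)
  have "(c ! i, c ! b) \<in> ?E" "(c ! i, c ! a) \<in> ?E"
    using adj[of i] adj[of a] i a b g(7) by auto
  moreover have "c ! a \<noteq> c ! b"
    using dist ab a b by (simp add: nth_eq_iff_index_eq)
  ultimately have "(c ! a, c ! b) \<in> ?E"
    using v(2) a b i by (auto simp: pairwise_def)
  then show "\<exists>i<?n. \<exists>j<?n. i \<noteq> j \<and> j \<noteq> Suc i mod ?n \<and> i \<noteq> Suc j mod ?n \<and> (c ! i, c ! j) \<in> ?E"
    using a b ab by blast
qed

lemma ex_perfect_elim_if_chordal:
  assumes "pair_graph G" "chordal G" "clique G K"
  shows "\<exists>vs. distinct vs \<and> set vs = pverts G - K \<and> perfect_elim (parcs G) K vs"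
  using assms
proof (induction "card (pverts G)" arbitrary: G rule: less_induct)
  case less
  note g = pair_graphD[OF less.prems(1)]
  show ?case
  proof (cases "K = pverts G")
    case True
    then show ?thesis by (intro exI[of _ "[]"]) simp
  next
    case False
    obtain v where v: "v \<in> pverts G - K" "complete_on (parcs G) {u. (v, u) \<in> parcs G}"
      using ex_simplicial_outside_clique[OF less.prems False] by blast
    let ?H = "induced G (pverts G - {v})"
    have "card (pverts ?H) < card (pverts G)"
      using v(1) g(1) card_Diff1_less[of "pverts G" v] by simp
    moreover have "clique ?H K"
      using less.prems(3) v(1) by (auto simp: clique_iff pairwise_def)
    ultimately obtain vs where vs: "distinct vs" "set vs = pverts ?H - K"
        "perfect_elim (parcs ?H) K vs"
      using less.hyps[of ?H] pair_graph_induced[OF less.prems(1)]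
        chordal_induced[OF less.prems(2)] by auto
    have "K \<subseteq> pverts G" using less.prems(3) by (simp add: clique_iff)
    then have "perfect_elim (parcs G) K vs"
      using v(1) vs(2) by (intro perfect_elim_transfer[OF vs(3)]) auto
    moreover have "complete_on (parcs G) {x \<in> set vs \<union> K. (v, x) \<in> parcs G}"
      using v(2) by (rule pairwise_subset) auto
    ultimately show ?thesis
      using vs v(1) by (intro exI[of _ "v # vs"]) auto
  qed
qed

lemma chordal_iff_perfect_elim:
  assumes "pair_graph G"
  shows "chordal G \<longleftrightarrow> (\<exists>vs. distinct vs \<and> set vs = pverts G \<and> perfect_elim (parcs G) {} vs)"
proof
  assume "chordal G"
  then show "\<exists>vs. distinct vs \<and> set vs = pverts G \<and> perfect_elim (parcs G) {} vs"
    using ex_perfect_elim_if_chordal[OF assms, of "{}"] by (simp add: clique_iff)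
qed (use chordal_if_perfect_elim[OF assms] in blast)

section \<open>The fill-in graph\<close>

text \<open>
  The graph before step \<open>m\<close> of the fill-in, counting from 0.
\<close>

definition partial_fill_in :: "'a pair_pre_digraph \<Rightarrow> 'a list \<Rightarrow> nat \<Rightarrow> 'a pair_pre_digraph" where
  "partial_fill_in G \<pi> m = fold (fill_step \<pi>) [0..<m] G"

lemma fill_in_eq: "fill_in G \<pi> = partial_fill_in G \<pi> (length \<pi>)"
  by (simp add: fill_in_def partial_fill_in_def)

lemma partial_fill_in_0 [simp]: "partial_fill_in G \<pi> 0 = G"
  by (simp add: partial_fill_in_def)

lemma partial_fill_in_Suc: "partial_fill_in G \<pi> (Suc m) = fill_step \<pi> m (partial_fill_in G \<pi> m)"
  by (simp add: partial_fill_in_def)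

lemma partial_fill_in_mono:
  assumes "m \<le> n"
  shows "parcs (partial_fill_in G \<pi> m) \<subseteq> parcs (partial_fill_in G \<pi> n)"
  using assms by (induction rule: dec_induct) (auto simp: partial_fill_in_Suc fill_step_def)

lemma pverts_partial_fill_in [simp]: "pverts (partial_fill_in G \<pi> m) = pverts G"
  by (induction m) (auto simp: partial_fill_in_Suc fill_step_def)

lemma pair_graph_fill_step:
  assumes "pair_graph H" "vertex_ordering H \<pi>"
  shows "pair_graph (fill_step \<pi> i H)"
proof -
  have "\<pi> ! j \<in> pverts H" if "j < length \<pi>" for j
    using assms(2) nth_mem[OF that] unfolding vertex_ordering_def by blast
  moreover have "\<pi> ! j \<noteq> \<pi> ! l" if "j < length \<pi>" "l < length \<pi>" "j \<noteq> l" for j l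
    using assms(2) that by (simp add: vertex_ordering_def nth_eq_iff_index_eq)
  ultimately show ?thesis
    using assms(1) unfolding pair_graph_iff fill_step_def sym_def irrefl_def by auto
qed

lemma pair_graph_partial_fill_in:
  assumes "pair_graph G" "vertex_ordering G \<pi>"
  shows "pair_graph (partial_fill_in G \<pi> m)"
proof (induction m)
  case (Suc m)
  moreover have "vertex_ordering (partial_fill_in G \<pi> m) \<pi>"
    using assms(2) by (simp add: vertex_ordering_def)
  ultimately show ?case
    unfolding partial_fill_in_Suc by (rule pair_graph_fill_step)
qed (use assms in simp)

text \<open>
  From step \<open>i\<close> on all added edges join vertices of index greater than \<open>i\<close>. Hence the higher
  neighbours of \<open>\<pi> ! i\<close> in the final graph are those that step \<open>i\<close> makes adjacent to each other.
\<close>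

lemma partial_fill_in_stable:
  assumes "distinct \<pi>" "i < length \<pi>" "i \<le> m" "(\<pi> ! i, x) \<in> parcs (partial_fill_in G \<pi> m)"
  shows "(\<pi> ! i, x) \<in> parcs (partial_fill_in G \<pi> i)"
  using assms(3,4)
proof (induction rule: dec_induct)
  case (step n)
  then show ?case
    using assms(1,2)
    by (auto simp: partial_fill_in_Suc fill_step_def nth_eq_iff_index_eq)
qed

lemma perfect_elim_fill_in:
  assumes G: "pair_graph G" "vertex_ordering G \<pi>"
  shows "perfect_elim (parcs (fill_in G \<pi>)) {} \<pi>"
proof (rule perfect_elimI_nth)
  fix i j l
  assume ij: "i < j" "i < l" "j < length \<pi>" "l < length \<pi>" "j \<noteq> l"
    and "(\<pi> ! i, \<pi> ! j) \<in> parcs (fill_in G \<pi>)" "(\<pi> ! i, \<pi> ! l) \<in> parcs (fill_in G \<pi>)"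
  then have "(\<pi> ! i, \<pi> ! j) \<in> parcs (partial_fill_in G \<pi> i)"
    "(\<pi> ! i, \<pi> ! l) \<in> parcs (partial_fill_in G \<pi> i)"
    using partial_fill_in_stable[of \<pi> i "length \<pi>"] G(2)
    by (auto simp: fill_in_eq vertex_ordering_def)
  then have "(\<pi> ! j, \<pi> ! i) \<in> parcs (partial_fill_in G \<pi> i)"
    "(\<pi> ! l, \<pi> ! i) \<in> parcs (partial_fill_in G \<pi> i)"
    by (blast intro: symD[OF pair_graphD(3)[OF pair_graph_partial_fill_in[OF G]]])+
  then have "(\<pi> ! j, \<pi> ! l) \<in> parcs (partial_fill_in G \<pi> (Suc i))"
    using ij by (auto simp: partial_fill_in_Suc fill_step_def)
  then show "(\<pi> ! j, \<pi> ! l) \<in> parcs (fill_in G \<pi>)"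
    using partial_fill_in_mono[of "Suc i" "length \<pi>" G \<pi>] ij by (auto simp: fill_in_eq)
qed

lemma fill_in_minimal:
  assumes "sym F" "perfect_elim F {} \<pi>" "distinct \<pi>" "parcs G \<subseteq> F"
  shows "parcs (fill_in G \<pi>) \<subseteq> F"
proof -
  have "parcs (partial_fill_in G \<pi> m) \<subseteq> F" for m
  proof (induction m)
    case (Suc m)
    have "(\<pi> ! j, \<pi> ! l) \<in> F"
      if "m < j" "m < l" "j < length \<pi>" "l < length \<pi>" "j \<noteq> l"
        "(\<pi> ! j, \<pi> ! m) \<in> parcs (partial_fill_in G \<pi> m)"
        "(\<pi> ! l, \<pi> ! m) \<in> parcs (partial_fill_in G \<pi> m)" for j l
    proof (rule perfect_elim_nth[OF assms(2) that(1-4)])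
      show "\<pi> ! j \<noteq> \<pi> ! l" using that assms(3) by (simp add: nth_eq_iff_index_eq)
      show "(\<pi> ! m, \<pi> ! j) \<in> F" "(\<pi> ! m, \<pi> ! l) \<in> F"
        using that(6,7) Suc by (auto intro: symD[OF assms(1)])
    qed
    then show ?case
      using Suc by (auto simp: partial_fill_in_Suc fill_step_def)
  qed (use assms in simp)
  then show ?thesis by (simp add: fill_in_eq)
qed

text \<open>
  A perfect elimination ordering of the supergraph is blended: as the fill-in graph is contained in
  the supergraph, each vertex together with its higher neighbours is a clique there. If it has at
  least \<open>k + 2\<close> vertices, all its subsets of this size are cliques of \<open>G\<close>.
\<close>

lemma blended_ordering_if_clique_chordal_supergraph:
  assumes "clique_chordal_supergraph (k + 1) G G'"
  shows "\<exists>\<pi>. blended_elimination_ordering k G \<pi>"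
proof -
  have G': "pair_graph G'" "pverts G = pverts G'" "parcs G \<subseteq> parcs G'" "chordal G'"
    and cl: "\<And>K. clique G' K \<Longrightarrow> card K = k + 2 \<Longrightarrow> clique G K"
    using assms by (auto simp: clique_chordal_supergraph_def)
  note g = pair_graphD[OF G'(1)]
  obtain \<pi> where \<pi>: "distinct \<pi>" "set \<pi> = pverts G'" "perfect_elim (parcs G') {} \<pi>"
    using G'(4) chordal_iff_perfect_elim[OF G'(1)] by blast
  have sub: "parcs (fill_in G \<pi>) \<subseteq> parcs G'"
    by (rule fill_in_minimal[OF g(3) \<pi>(3,1) G'(3)])
  have "clique G (insert (\<pi> ! i) (higher_nbs G \<pi> i))"
    if i: "i < length \<pi>" and big: "\<not> card (higher_nbs G \<pi> i) \<le> k" for i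
  proof (rule clique_if_small_subsets_cliques[where n = "k + 2"])
    let ?N = "higher_nbs G \<pi> i"
    have N: "?N \<subseteq> {\<pi> ! j | j. i < j \<and> j < length \<pi> \<and> (\<pi> ! i, \<pi> ! j) \<in> parcs G'}"
      using sub by (auto simp: higher_nbs_def)
    have "complete_on (parcs G') {\<pi> ! j | j. i < j \<and> j < length \<pi> \<and> (\<pi> ! i, \<pi> ! j) \<in> parcs G'}"
      using perfect_elim_nth[OF \<pi>(3)] by (auto simp: pairwise_def)
    then have "complete_on (parcs G') ?N"
      by (rule pairwise_subset[OF _ N])
    moreover have "(\<pi> ! i, x) \<in> parcs G'" "(x, \<pi> ! i) \<in> parcs G'" if "x \<in> ?N" for x
    proof -
      show "(\<pi> ! i, x) \<in> parcs G'" using that N by blast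
      then show "(x, \<pi> ! i) \<in> parcs G'" by (rule g(7))
    qed
    ultimately have "complete_on (parcs G') (insert (\<pi> ! i) ?N)"
      by (simp add: pairwise_insert)
    moreover have "insert (\<pi> ! i) ?N \<subseteq> pverts G'"
      using N i \<pi>(2) nth_mem by fastforce
    ultimately have "clique G' (insert (\<pi> ! i) ?N)"
      by (simp add: clique_iff)
    then show "clique G K" if "K \<subseteq> insert (\<pi> ! i) ?N" "card K = k + 2" for K
      using that cl clique_subset by blast
    have "finite ?N"
      by (rule ccontr) (use big in simp)
    moreover have "\<pi> ! i \<notin> ?N"
      using \<pi>(1) i by (auto simp: higher_nbs_def nth_eq_iff_index_eq)
    ultimately show "k + 2 \<le> card (insert (\<pi> ! i) ?N)"
      using big by simp
  qed simp
  then have "blended_elimination_ordering k G \<pi>"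
    using \<pi> G'(2) by (auto simp: blended_elimination_ordering_def vertex_ordering_def)
  then show ?thesis ..
qed

text \<open>
  A clique of the fill-in graph consists of its first vertex and some higher neighbours of it. If
  there are more than \<open>k\<close> of them, the second alternative for this vertex is excluded.
\<close>

lemma clique_chordal_supergraph_fill_in:
  assumes G: "pair_graph G" and b: "blended_elimination_ordering k G \<pi>"
  shows "clique_chordal_supergraph (k + 1) G (fill_in G \<pi>)"
  unfolding clique_chordal_supergraph_def
proof (intro conjI allI impI)
  let ?H = "fill_in G \<pi>"
  have ord: "vertex_ordering G \<pi>"
    using b by (simp add: blended_elimination_ordering_def)
  show H: "pair_graph ?H"
    unfolding fill_in_eq by (rule pair_graph_partial_fill_in[OF G ord])
  show V: "pverts G = pverts ?H"
    by (simp add: fill_in_eq)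
  show "parcs G \<subseteq> parcs ?H"
    using partial_fill_in_mono[of 0 "length \<pi>" G \<pi>] by (simp add: fill_in_eq)
  show "chordal ?H"
    using ord V by (intro chordal_if_perfect_elim[OF H _ perfect_elim_fill_in[OF G ord]])
      (simp add: vertex_ordering_def)
  fix K assume K: "clique ?H K \<and> card K = k + 1 + 1"
  let ?I = "{i. i < length \<pi> \<and> \<pi> ! i \<in> K}"
  have KV: "K \<subseteq> set \<pi>"
    using K ord V by (simp add: clique_iff vertex_ordering_def)
  have fin: "finite K" by (rule ccontr) (use K in simp)
  have ne: "K \<noteq> {}" using K by auto
  have "?I \<noteq> {}" using ne KV by (auto simp: in_set_conv_nth subset_iff)
  \<comment> \<open>the position of the first vertex of \<open>K\<close>\<close>
  define i where "i = Min ?I"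
  have i: "i < length \<pi>" "\<pi> ! i \<in> K"
    using Min_in[of ?I] \<open>?I \<noteq> {}\<close> by (auto simp: i_def)
  have low: "i \<le> j" if "j < length \<pi>" "\<pi> ! j \<in> K" for j
    using Min_le[of ?I j] that by (simp add: i_def)
  have KN: "K - {\<pi> ! i} \<subseteq> higher_nbs G \<pi> i"
  proof
    fix x assume x: "x \<in> K - {\<pi> ! i}"
    then obtain j where j: "j < length \<pi>" "x = \<pi> ! j"
      using KV by (auto simp: in_set_conv_nth subset_iff)
    then have "i < j" using low[of j] x by (metis DiffE le_neq_implies_less singletonI)
    moreover have "(\<pi> ! i, x) \<in> parcs ?H"
      using K i x by (auto simp: clique_def)
    ultimately show "x \<in> higher_nbs G \<pi> i"
      using j by (auto simp: higher_nbs_def)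
  qed
  have "finite (higher_nbs G \<pi> i)" by (simp add: higher_nbs_def)
  then have "k + 1 \<le> card (higher_nbs G \<pi> i)"
    using card_mono[OF _ KN] K i fin by simp
  then have "clique G (insert (\<pi> ! i) (higher_nbs G \<pi> i))"
    using b i(1) by (auto simp: blended_elimination_ordering_def)
  moreover have "K \<subseteq> insert (\<pi> ! i) (higher_nbs G \<pi> i)"
    using KN by blast
  ultimately show "clique G K"
    by (rule clique_subset)
qed

section \<open>Clique-sums of chordal supergraphs\<close>

text \<open>
  The edges of the second graph between vertices of the first one join vertices of the clique \<open>L\<close>,
  so they belong to the first graph already. Stated for one side; the two sides of a clique-sum are
  obtained by exchanging the roles.
\<close>

lemma clique_in_union_of_images:
  assumes inj: "inj_on f V" and E: "E \<subseteq> E'" "E' \<subseteq> V \<times> V" and L: "complete_on E L"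
    and F: "F \<subseteq> W \<times> W" and meet: "\<And>x y. x \<in> V \<Longrightarrow> y \<in> W \<Longrightarrow> f x = g y \<Longrightarrow> x \<in> L"
    and Q: "Q \<subseteq> f ` V" "complete_on (map_prod f f ` E' \<union> map_prod g g ` F) Q"
  obtains Q' where "Q' \<subseteq> V" "Q = f ` Q'" "card Q' = card Q" "complete_on E' Q'"
proof -
  obtain Q' where Q': "Q' \<subseteq> V" "Q = f ` Q'"
    using Q(1) by (auto simp: subset_image_iff)
  have "card Q' = card Q"
    using card_image[OF inj_on_subset[OF inj Q'(1)]] Q'(2) by simp
  moreover have "complete_on E' Q'"
  proof (rule pairwiseI)
    fix x y assume xy: "x \<in> Q'" "y \<in> Q'" "x \<noteq> y"
    then have V: "x \<in> V" "y \<in> V" and "f x \<noteq> f y"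
      using Q'(1) inj by (auto simp: inj_on_def)
    then have "(f x, f y) \<in> map_prod f f ` E' \<union> map_prod g g ` F"
      using Q(2) xy Q'(2) by (auto simp: pairwise_def)
    then show "(x, y) \<in> E'"
    proof
      assume "(f x, f y) \<in> map_prod f f ` E'"
      then obtain a b where ab: "(a, b) \<in> E'" "f x = f a" "f y = f b" by auto
      then have mem: "a \<in> V" "b \<in> V" using E(2) by auto
      have "x = a" "y = b"
        using inj_onD[OF inj ab(2) V(1) mem(1)] inj_onD[OF inj ab(3) V(2) mem(2)] .
      then show ?thesis using ab(1) by simp
    next
      assume "(f x, f y) \<in> map_prod g g ` F"
      then obtain a b where ab: "(a, b) \<in> F" "f x = g a" "f y = g b" by auto
      then have "x \<in> L" "y \<in> L" using F V meet by auto
      then show ?thesis using L E(1) xy(3) by (auto simp: pairwise_def)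
    qed
  qed
  ultimately show ?thesis using that Q' by blast
qed

text \<open>
  The same identification is applied to the supergraphs. Chordality: eliminate the part of the
  second graph outside of the common clique, which is possible by \<open>ex_perfect_elim_if_chordal\<close>, and
  then the first graph. Cliques: there are no edges between the two sides, so every clique lies in
  one side, where it comes from a clique of the same size.
\<close>

lemma clique_chordal_supergraph_clique_sum:
  assumes G: "is_clique_sum G1 G2 G"
    and s1: "clique_chordal_supergraph m G1 H1" and s2: "clique_chordal_supergraph m G2 H2"
  shows "\<exists>H. clique_chordal_supergraph m G H"
proof -
  obtain K1 K2 \<phi> f1 f2 where K: "clique G1 K1" "clique G2 K2" "bij_betw \<phi> K1 K2"
    and inj: "inj_on f1 (pverts G1)" "inj_on f2 (pverts G2)"
    and glue: "\<And>x y. x \<in> pverts G1 \<Longrightarrow> y \<in> pverts G2 \<Longrightarrow> f1 x = f2 y \<longleftrightarrow> x \<in> K1 \<and> y = \<phi> x"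
    and V: "pverts G = f1 ` pverts G1 \<union> f2 ` pverts G2"
    and E: "parcs G = map_prod f1 f1 ` parcs G1 \<union> map_prod f2 f2 ` parcs G2"
    using G unfolding is_clique_sum_def by metis
  have H1: "pair_graph H1" "pverts G1 = pverts H1" "parcs G1 \<subseteq> parcs H1" "chordal H1"
    and cl1: "\<And>K. clique H1 K \<Longrightarrow> card K = m + 1 \<Longrightarrow> clique G1 K"
    using s1 by (auto simp: clique_chordal_supergraph_def)
  have H2: "pair_graph H2" "pverts G2 = pverts H2" "parcs G2 \<subseteq> parcs H2" "chordal H2"
    and cl2: "\<And>K. clique H2 K \<Longrightarrow> card K = m + 1 \<Longrightarrow> clique G2 K"
    using s2 by (auto simp: clique_chordal_supergraph_def)
  note h1 = pair_graphD[OF H1(1)] and h2 = pair_graphD[OF H2(1)]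
  let ?V1 = "pverts H1" and ?V2 = "pverts H2" and ?E1 = "parcs H1" and ?E2 = "parcs H2"
  let ?F1 = "map_prod f1 f1 ` ?E1" and ?F2 = "map_prod f2 f2 ` ?E2"
  note inj = inj[unfolded H1(2) H2(2)] and glue = glue[unfolded H1(2) H2(2)]
    and V = V[unfolded H1(2) H2(2)]
  have K1: "K1 \<subseteq> ?V1" "complete_on (parcs G1) K1" and K2: "K2 \<subseteq> ?V2" "complete_on (parcs G2) K2"
    using K H1(2) H2(2) by (auto simp: clique_iff)
  have meet1: "x \<in> K1" and meet2: "y \<in> K2" if "x \<in> ?V1" "y \<in> ?V2" "f1 x = f2 y" for x y
    using glue[OF that(1,2)] that(3) bij_betwE[OF K(3)] by auto
  define H where "H = \<lparr>pverts = pverts G, parcs = ?F1 \<union> ?F2\<rparr>"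
  have H: "pverts H = f1 ` ?V1 \<union> f2 ` ?V2" "parcs H = ?F1 \<union> ?F2"
    by (simp_all add: H_def V)
  have F1: "?F1 \<subseteq> f1 ` ?V1 \<times> f1 ` ?V1" and F2: "?F2 \<subseteq> f2 ` ?V2 \<times> f2 ` ?V2"
    using h1(2) h2(2) by auto
  have "pair_graph H"
    unfolding pair_graph_iff
  proof (intro conjI)
    show "finite (pverts H)" using h1(1) h2(1) H by simp
    show "parcs H \<subseteq> pverts H \<times> pverts H" using F1 F2 unfolding H by blast
    show "sym (parcs H)"
      unfolding H by (rule sym_Un; rule symI) (use h1(7) h2(7) in auto)
    have "f1 x \<noteq> f1 y" if "(x, y) \<in> ?E1" for x y
      using inj_onD[OF inj(1), of x y] h1(5,6,8) that by auto
    moreover have "f2 x \<noteq> f2 y" if "(x, y) \<in> ?E2" for x y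
      using inj_onD[OF inj(2), of x y] h2(5,6,8) that by auto
    ultimately show "irrefl (parcs H)"
      unfolding H irrefl_def by fastforce
  qed
  moreover have "chordal H"
  proof -
    obtain vs where vs: "set vs = ?V1" "perfect_elim ?E1 {} vs"
      using H1(1,4) chordal_iff_perfect_elim by blast
    have "clique H2 K2"
      using K(2) H2(2,3) by (auto simp: clique_iff pairwise_def)
    then obtain us where us: "set us = ?V2 - K2" "perfect_elim ?E2 K2 us"
      using ex_perfect_elim_if_chordal[OF H2(1,4)] by blast
    have U: "set us \<union> K2 = ?V2" using us(1) K2(1) by blast
    have sep: "f2 y \<notin> f1 ` ?V1" if "y \<in> set us" for y
      using that us(1) meet2 by force
    have sub: "x \<in> set (map f1 vs) \<union> f2 ` K2" if "x \<in> f1 ` ?V1" for x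
      using that vs(1) by auto
    have "perfect_elim ?F2 (f2 ` K2) (map f2 us)"
      using us(2) inj(2) h2(2) U by (intro perfect_elim_map) auto
    then have "perfect_elim (parcs H) (set (map f1 vs)) (map f2 us)"
    proof (rule perfect_elim_transfer)
      fix v x assume v: "v \<in> set (map f2 us)" and x: "x \<in> set (map f2 us) \<union> set (map f1 vs)"
        and vH: "(v, x) \<in> parcs H"
      have "v \<notin> f1 ` ?V1" using v sep by auto
      then have "(v, x) \<notin> ?F1" using F1 by blast
      then have vx: "(v, x) \<in> ?F2" using vH unfolding H by blast
      have "x \<in> f2 ` K2" if xin: "x \<in> set (map f1 vs)"
      proof -
        obtain a where a: "a \<in> ?V1" "x = f1 a" using xin vs(1) by auto
        obtain y where y: "y \<in> ?V2" "x = f2 y" using vx F2 by auto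
        then show ?thesis using meet2[OF a(1) y(1)] a y by auto
      qed
      then show "(v, x) \<in> ?F2 \<and> (x \<in> set (map f1 vs) \<longrightarrow> x \<in> f2 ` K2)"
        using vx by blast
    next
      fix x y assume "(x, y) \<in> ?F2"
      then show "(x, y) \<in> parcs H" unfolding H by blast
    qed
    moreover have "perfect_elim (parcs H) {} (map f1 vs)"
    proof -
      have "perfect_elim ?F1 (f1 ` {}) (map f1 vs)"
        using vs inj(1) h1(2) by (intro perfect_elim_map) auto
      then have *: "perfect_elim ?F1 {} (map f1 vs)" by simp
      show ?thesis
      proof (rule perfect_elim_transfer[OF *])
        fix v x assume v: "v \<in> set (map f1 vs)" and x: "x \<in> set (map f1 vs) \<union> {}"
          and vx: "(v, x) \<in> parcs H"
        obtain a b where a: "a \<in> ?V1" "v = f1 a" and b: "b \<in> ?V1" "x = f1 b"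
          using v x vs(1) by auto
        \<comment> \<open>Edges of the second graph between vertices of the first one join vertices of the common
          clique, so they are edges of the first graph.\<close>
        have via_K1: "(f1 a, f1 b) \<in> ?F1" if "(f1 a, f1 b) \<in> ?F2"
        proof -
          obtain c d where cd: "(c, d) \<in> ?E2" "f1 a = f2 c" "f1 b = f2 d" using \<open>(f1 a, f1 b) \<in> ?F2\<close> by auto
          have "a \<in> K1" "b \<in> K1"
            using meet1[OF a(1) h2(5)[OF cd(1)] cd(2)] meet1[OF b(1) h2(6)[OF cd(1)] cd(3)] .
          moreover have "c \<noteq> d" using cd(1) h2(8) by auto
          then have "a \<noteq> b" using cd inj_onD[OF inj(2), of c d] h2(5,6) by auto
          ultimately have "(a, b) \<in> ?E1" using K1(2) H1(3) by (auto simp: pairwise_def)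
          then show ?thesis by (rule map_prod_imageI[of a b ?E1 f1 f1])
        qed
        have "(f1 a, f1 b) \<in> ?F1 \<or> (f1 a, f1 b) \<in> ?F2"
          using vx unfolding H a(2) b(2) by blast
        then have "(f1 a, f1 b) \<in> ?F1"
          by (elim disjE) (assumption, rule via_K1, assumption)
        then show "(v, x) \<in> ?F1 \<and> (x \<in> {} \<longrightarrow> x \<in> {})"
          unfolding a(2) b(2) by blast
      next
        fix x y assume "(x, y) \<in> ?F1"
        then show "(x, y) \<in> parcs H" unfolding H by blast
      qed
    qed
    ultimately have "perfect_elim (parcs H) {} (map f2 us @ map f1 vs)"
      by (simp add: perfect_elim_append)
    moreover have "f2 ` K2 \<subseteq> f1 ` ?V1"
    proof
      fix z assume "z \<in> f2 ` K2"
      then obtain x where x: "x \<in> K1" "z = f2 (\<phi> x)"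
        using K(3) by (auto simp: bij_betw_def)
      then have "f1 x = f2 (\<phi> x)"
        using glue[of x "\<phi> x"] K1(1) K2(1) bij_betwE[OF K(3)] by auto
      then have "z = f1 x" using x(2) by simp
      then show "z \<in> f1 ` ?V1" using x(1) K1(1) by blast
    qed
    then have "set (map f2 us @ map f1 vs) = pverts H"
      using us(1) vs(1) K2(1) unfolding H by auto
    ultimately show ?thesis
      using \<open>pair_graph H\<close> chordal_if_perfect_elim by blast
  qed
  moreover have "clique G Q" if Q: "clique H Q" "card Q = m + 1" for Q
  proof -
    have QE: "complete_on (?F1 \<union> ?F2) Q" and QV: "Q \<subseteq> f1 ` ?V1 \<union> f2 ` ?V2"
      using Q(1) unfolding clique_iff H by auto
    have "Q \<subseteq> f1 ` ?V1 \<or> Q \<subseteq> f2 ` ?V2"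
    proof (rule ccontr)
      assume "\<not> (Q \<subseteq> f1 ` ?V1 \<or> Q \<subseteq> f2 ` ?V2)"
      then obtain q r where qr: "q \<in> Q" "q \<notin> f1 ` ?V1" "r \<in> Q" "r \<notin> f2 ` ?V2" by blast
      then have "q \<noteq> r" using QV by blast
      then have "(q, r) \<in> ?F1 \<union> ?F2" using QE qr by (auto simp only: pairwise_def)
      then show False using F1 F2 qr by blast
    qed
    then show ?thesis
    proof
      assume Q1: "Q \<subseteq> f1 ` ?V1"
      obtain Q' where Q': "Q' \<subseteq> ?V1" "Q = f1 ` Q'" "card Q' = card Q" "complete_on ?E1 Q'"
        by (rule clique_in_union_of_images[OF inj(1) H1(3) h1(2) K1(2) h2(2) meet1 Q1 QE])
      then have "clique G1 Q'" using cl1 Q(2) by (simp add: clique_iff)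
      then show "clique G Q"
        unfolding Q'(2) by (rule clique_image) (auto simp only: V E H1(2))
    next
      assume Q2: "Q \<subseteq> f2 ` ?V2"
      have QE': "complete_on (?F2 \<union> ?F1) Q" using QE by (simp only: Un_commute)
      have meet2': "y \<in> K2" if "y \<in> ?V2" "x \<in> ?V1" "f2 y = f1 x" for x y
        by (rule meet2[OF that(2,1) that(3)[symmetric]])
      obtain Q' where Q': "Q' \<subseteq> ?V2" "Q = f2 ` Q'" "card Q' = card Q" "complete_on ?E2 Q'"
        by (rule clique_in_union_of_images[OF inj(2) H2(3) h2(2) K2(2) h1(2) meet2' Q2 QE'])
      then have "clique G2 Q'" using cl2 Q(2) by (simp add: clique_iff)
      then show "clique G Q"
        unfolding Q'(2) by (rule clique_image) (auto simp only: V E H2(2))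
    qed
  qed
  moreover have "parcs G \<subseteq> parcs H"
    using H1(3) H2(3) unfolding H E by blast
  ultimately show ?thesis
    unfolding clique_chordal_supergraph_def by (intro exI[of _ H]) (simp add: H_def)
qed

lemma clique_sum_of_imp_clique_chordal_supergraph:
  assumes "clique_sum_of M G"
    and "\<And>H. H \<in># M \<Longrightarrow> pair_graph H \<Longrightarrow> \<exists>H'. clique_chordal_supergraph m H H'"
  shows "\<exists>G'. clique_chordal_supergraph m G G'"
  using assms
proof (induction rule: clique_sum_of.induct)
  case (single G)
  then show ?case by simp
next
  case (sum M1 G1 M2 G2 G)
  then obtain H1 H2 where "clique_chordal_supergraph m G1 H1" "clique_chordal_supergraph m G2 H2"
    by (metis union_iff)
  with sum.hyps(3) show ?case
    by (rule clique_chordal_supergraph_clique_sum)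
qed

section \<open>Connectedness and trees\<close>

lemma connected_iff:
  assumes "pair_graph T"
  shows "Digraph_Component.connected (with_proj T) \<longleftrightarrow>
    pverts T \<noteq> {} \<and> (\<forall>x\<in>pverts T. \<forall>y\<in>pverts T. (x, y) \<in> rtrancl_on (pverts T) (parcs T))"
proof -
  have "(\<Union>(a, b)\<in>parcs T. {(a, b), (b, a)}) = parcs T"
    using pair_graphD(7)[OF assms] by auto
  then show ?thesis
    by (simp add: connected_def strongly_connected_def mk_symmetric_def reachable_def
        case_prod_unfold)
qed

lemma induced_eq_induce_subgraph: "with_proj T \<restriction> S = with_proj (induced T S)"
  by (auto simp: induce_subgraph_def with_proj_def induced_def)

lemma rtrancl_on_Int: "rtrancl_on S (E \<inter> S \<times> S) = rtrancl_on S E"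
proof -
  have "(x, y) \<in> rtrancl_on S (E \<inter> S \<times> S)" if "(x, y) \<in> rtrancl_on S E" for x y
    using that
  proof (induction rule: rtrancl_on_induct)
    case (step y z)
    then show ?case by (auto intro: rtrancl_on_into_rtrancl_on)
  qed simp
  then show ?thesis
    by (auto intro: rtrancl_on_mono[OF Int_lower1 subset_refl])
qed

lemma connected_induce_iff:
  assumes "pair_graph T" "S \<subseteq> pverts T"
  shows "Digraph_Component.connected (with_proj T \<restriction> S) \<longleftrightarrow>
    S \<noteq> {} \<and> (\<forall>x\<in>S. \<forall>y\<in>S. (x, y) \<in> rtrancl_on S (parcs T))"
  unfolding induced_eq_induce_subgraph connected_iff[OF pair_graph_induced[OF assms]]
  by (simp add: rtrancl_on_Int)

text \<open>
  A path through a simplicial vertex \<open>t\<close> can bypass it, as the vertices before and after \<open>t\<close> are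
  adjacent or equal.
\<close>

lemma rtrancl_on_remove_simplicial:
  assumes "sym E" "complete_on E {z \<in> F - {t}. (t, z) \<in> E}"
    and "(x, y) \<in> rtrancl_on F E" "x \<noteq> t" "y \<noteq> t"
  shows "(x, y) \<in> rtrancl_on (F - {t}) E"
proof -
  have "(y \<noteq> t \<longrightarrow> (x, y) \<in> rtrancl_on (F - {t}) E) \<and>
    (y = t \<longrightarrow> (\<exists>z\<in>F - {t}. (t, z) \<in> E \<and> (x, z) \<in> rtrancl_on (F - {t}) E))"
    using assms(3)
  proof (induction rule: rtrancl_on_induct)
    case base
    then show ?case using \<open>x \<noteq> t\<close> by simp
  next
    case (step y z)
    show ?case
    proof (cases "y = t")
      case True
      then obtain w where w: "w \<in> F - {t}" "(t, w) \<in> E" "(x, w) \<in> rtrancl_on (F - {t}) E"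
        using step.IH by blast
      show ?thesis
      proof (cases "z = t \<or> z = w")
        case True
        then show ?thesis using w by blast
      next
        case False
        then have "(w, z) \<in> E"
          using assms(2) w step.hyps \<open>y = t\<close> by (auto simp: pairwise_def)
        then show ?thesis
          using w(3) False step.hyps by (auto intro: rtrancl_on_into_rtrancl_on)
      qed
    next
      case False
      then have xy: "(x, y) \<in> rtrancl_on (F - {t}) E" using step.IH by blast
      have "(z, y) \<in> E" using step.hyps(2) assms(1) by (simp add: symD)
      then show ?thesis
        using xy False step.hyps by (auto intro: rtrancl_on_into_rtrancl_on)
    qed
  qed
  then show ?thesis using assms(5) by blast
qed

lemma undirected_tree_single: "undirected_tree \<lparr>pverts = {t}, parcs = {}\<rparr>"
proof -
  have "pair_graph \<lparr>pverts = {t}, parcs = {}\<rparr>"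
    by (simp add: pair_graph_iff sym_def irrefl_def)
  moreover have False if "graph_cycle \<lparr>pverts = {t}, parcs = {}\<rparr> c" for c
    using that by (cases c) (auto simp: graph_cycle_def)
  ultimately show ?thesis
    by (auto simp: undirected_tree_def connected_iff)
qed

text \<open>
  A cycle through the new vertex \<open>n\<close> would contain \<open>t\<close> twice, as the predecessor and as the
  successor of \<open>n\<close>.
\<close>

lemma undirected_tree_add_leaf:
  assumes T: "undirected_tree T" and t: "t \<in> pverts T" and n: "n \<notin> pverts T"
  shows "undirected_tree \<lparr>pverts = insert n (pverts T), parcs = parcs T \<union> {(n, t), (t, n)}\<rparr>"
    (is "undirected_tree ?T")
  unfolding undirected_tree_def
proof (intro conjI)
  have pT: "pair_graph T" and cT: "Digraph_Component.connected (with_proj T)"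
    and aT: "\<nexists>c. graph_cycle T c"
    using T by (auto simp: undirected_tree_def)
  note g = pair_graphD[OF pT]
  show pT': "pair_graph ?T"
    using pT t n unfolding pair_graph_iff by (auto simp: sym_def irrefl_def)
  have base: "(x, y) \<in> rtrancl_on (pverts ?T) (parcs ?T)" if "x \<in> pverts T" "y \<in> pverts T" for x y
  proof -
    have "(x, y) \<in> rtrancl_on (pverts T) (parcs T)"
      using that cT connected_iff[OF pT] by blast
    then show ?thesis by (rule rtrancl_on_mono[rotated 2]) auto
  qed
  have "(x, y) \<in> rtrancl_on (pverts ?T) (parcs ?T)" if "x \<in> pverts ?T" "y \<in> pverts ?T" for x y
  proof -
    have from_t: "(t, y) \<in> rtrancl_on (pverts ?T) (parcs ?T)"
      using that(2) base[OF t t] base[OF t, of y]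
      by (cases "y = n") (auto intro: rtrancl_on_into_rtrancl_on)
    have to_t: "(x, t) \<in> rtrancl_on (pverts ?T) (parcs ?T)"
      using that(1) base[OF t t] base[of x t] t
      by (cases "x = n") (auto intro: converse_rtrancl_on_into_rtrancl_on)
    show ?thesis by (rule rtrancl_on_trans[OF to_t from_t])
  qed
  then show "Digraph_Component.connected (with_proj ?T)"
    unfolding connected_iff[OF pT'] by auto
  show "\<nexists>c. graph_cycle ?T c"
  proof
    assume "\<exists>c. graph_cycle ?T c"
    then obtain c where c: "length c \<ge> 3" "distinct c" "set c \<subseteq> insert n (pverts T)"
      and adj: "\<And>i. i < length c \<Longrightarrow> (c ! i, c ! (Suc i mod length c)) \<in> parcs ?T"
      by (auto simp: graph_cycle_def)
    show False
    proof (cases "n \<in> set c")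
      case False
      have "(c ! i, c ! (Suc i mod length c)) \<in> parcs T" if "i < length c" for i
      proof -
        have "Suc i mod length c < length c" using that by (intro mod_less_divisor) linarith
        then have "c ! i \<noteq> n" "c ! (Suc i mod length c) \<noteq> n"
          using False that nth_mem by metis+
        then show ?thesis using adj[OF that] by auto
      qed
      then have "graph_cycle T c"
        using c False by (auto simp: graph_cycle_def)
      then show False using aT by blast
    next
      case True
      then obtain i where i: "i < length c" "c ! i = n" by (metis in_set_conv_nth)
      let ?l = "length c"
      have "c \<noteq> []" using c(1) by auto
      \<comment> \<open>the positions before and after \<open>n\<close> on the cycle\<close>
      define a where "a = (if i = 0 then ?l - 1 else i - 1)"
      define b where "b = (if i = ?l - 1 then 0 else Suc i)"
      have b: "b = Suc i mod ?l" "b < ?l" and a: "a < ?l" "Suc a mod ?l = i"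
        using i c(1) \<open>c \<noteq> []\<close> by (auto simp: a_def b_def)
      have "a \<noteq> b"
        using i(1) c(1) by (auto simp: a_def b_def)
      have "(n, c ! b) \<in> parcs ?T" "(c ! a, n) \<in> parcs ?T"
        using adj[OF i(1)] adj[OF a(1)] i(2) a(2) b(1) by auto
      then have "c ! b = t" "c ! a = t"
        using n g(5,6) t by auto
      then show False
        using \<open>a \<noteq> b\<close> a(1) b(2) c(2) by (metis nth_eq_iff_index_eq)
    qed
  qed
qed

section \<open>From tree decompositions to chordal supergraphs\<close>

text \<open>
  The edges of the graph in which every bag is complete.
\<close>

definition share_bag :: "('b \<Rightarrow> 'a set) \<Rightarrow> 'b set \<Rightarrow> 'a rel" where
  "share_bag B S = {(u, v). u \<noteq> v \<and> (\<exists>t\<in>S. u \<in> B t \<and> v \<in> B t)}"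

text \<open>
  Induction along an elimination ordering of a forest, given here as a graph without triangles: the
  later neighbours of a node form a clique, so there is at most one. When the leaf \<open>t\<close> is removed,
  each vertex of its bag that occurs in another bag also occurs in the bag of the neighbour \<open>p\<close> of
  \<open>t\<close>, because its nodes are connected. So the remaining bags generate all edges between the
  remaining vertices. The vertices that occur only in the bag of \<open>t\<close> have all their neighbours in
  this bag and can be eliminated first.

  The last part of the conclusion says that every nonempty clique lies in a bag. It is found along
  the same induction, since a clique that contains one of the vertices which occur only in the bag
  of \<open>t\<close> lies in that bag.
\<close>

lemma perfect_elim_share_bag:
  assumes "sym E" "irrefl E" "distinct ts" "perfect_elim E {} ts"
    and "\<And>x y z. (x, y) \<in> E \<Longrightarrow> (y, z) \<in> E \<Longrightarrow> (x, z) \<in> E \<Longrightarrow> False"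
    and "\<And>t. t \<in> set ts \<Longrightarrow> finite (B t)"
    and "\<And>v s t. s \<in> set ts \<Longrightarrow> t \<in> set ts \<Longrightarrow> v \<in> B s \<Longrightarrow> v \<in> B t \<Longrightarrow>
      (s, t) \<in> rtrancl_on {t \<in> set ts. v \<in> B t} E"
  shows "\<exists>vs. distinct vs \<and> set vs = (\<Union>t\<in>set ts. B t) \<and>
    perfect_elim (share_bag B (set ts)) {} vs \<and>
    (\<forall>Q. Q \<noteq> {} \<longrightarrow> Q \<subseteq> set vs \<longrightarrow> complete_on (share_bag B (set ts)) Q \<longrightarrow> (\<exists>t\<in>set ts. Q \<subseteq> B t))"
  using assms(3,4,6,7)
proof (induction ts)
  case Nil
  show ?case by (intro exI[of _ "[]"]) simp
next
  case (Cons t ts)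
  let ?S = "\<lambda>v. {s \<in> set (t # ts). v \<in> B s}"
  let ?R = "share_bag B (set ts)" and ?R' = "share_bag B (set (t # ts))"
  let ?W = "\<Union>s\<in>set ts. B s"
  have sym: "(y, x) \<in> E" if "(x, y) \<in> E" for x y using assms(1) that by (rule symD)
  have nbs: "complete_on E {x \<in> set ts. (t, x) \<in> E}" and t: "t \<notin> set ts"
    using Cons.prems(1,2) by auto
  have unique: "x = y" if "x \<in> set ts" "y \<in> set ts" "(t, x) \<in> E" "(t, y) \<in> E" for x y
  proof (rule ccontr)
    assume "x \<noteq> y"
    then have "(x, y) \<in> E" using nbs that by (auto simp: pairwise_def)
    then show False using assms(5)[of t x y] that by blast
  qed
  have "(s, s') \<in> rtrancl_on {s \<in> set ts. v \<in> B s} E"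
    if "s \<in> set ts" "s' \<in> set ts" "v \<in> B s" "v \<in> B s'" for v s s'
  proof -
    have "(s, s') \<in> rtrancl_on (?S v) E"
      using that by (intro Cons.prems(4)) auto
    moreover have "complete_on E {z \<in> ?S v - {t}. (t, z) \<in> E}"
      using nbs by (rule pairwise_subset) auto
    ultimately have "(s, s') \<in> rtrancl_on (?S v - {t}) E"
      using that t by (intro rtrancl_on_remove_simplicial[OF assms(1)]) auto
    moreover have "?S v - {t} = {s \<in> set ts. v \<in> B s}" using t by auto
    ultimately show ?thesis by simp
  qed
  then obtain vs where vs: "distinct vs" "set vs = ?W" "perfect_elim ?R {} vs"
      and cliques: "\<And>Q. Q \<noteq> {} \<Longrightarrow> Q \<subseteq> set vs \<Longrightarrow> complete_on ?R Q \<Longrightarrow> \<exists>t\<in>set ts. Q \<subseteq> B t"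
    using Cons.IH Cons.prems(1-3) by force
  have later: "\<exists>p\<in>set ts. (t, p) \<in> E \<and> v \<in> B p" if v: "v \<in> B t" "v \<in> ?W" for v
  proof -
    obtain s where s: "s \<in> set ts" "v \<in> B s" using v(2) by blast
    then have "(t, s) \<in> rtrancl_on (?S v) E"
      using v by (intro Cons.prems(4)) auto
    then show ?thesis
    proof (cases rule: converse_rtrancl_on_cases)
      case base
      then show ?thesis using s t by blast
    next
      case (step p)
      then have "p \<in> ?S v" by (blast dest: in_rtrancl_on_in_F)
      moreover have "p \<noteq> t" using step(1) assms(2) by (auto simp: irrefl_def)
      ultimately show ?thesis using step(1) by auto
    qed
  qed
  \<comment> \<open>Two remaining vertices that share the bag of the leaf \<open>t\<close> also share the bag of its only
    neighbour.\<close>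
  have agree: "(u, v) \<in> ?R" if uv: "u \<in> ?W" "v \<in> ?W" "(u, v) \<in> ?R'" for u v
  proof (cases "u \<in> B t \<and> v \<in> B t")
    case True
    then obtain p q where pq: "p \<in> set ts" "(t, p) \<in> E" "u \<in> B p" "q \<in> set ts" "(t, q) \<in> E" "v \<in> B q"
      using later uv(1,2) by blast
    have "p = q" by (rule unique[OF pq(1,4,2,5)])
    then show ?thesis using pq uv(3) by (auto simp: share_bag_def)
  next
    case False
    then show ?thesis using uv(3) by (auto simp: share_bag_def)
  qed
  obtain ps where ps: "set ps = B t - ?W" "distinct ps"
    using Cons.prems(3)[of t] finite_distinct_list[of "B t - ?W"] by auto
  have priv: "x \<in> B t" if "p \<in> set ps" "(p, x) \<in> ?R'" for p x
    using that ps(1) by (auto simp: share_bag_def)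
  have "perfect_elim ?R' (set vs \<union> {}) ps'" if "set ps' \<subseteq> set ps" for ps'
    using that
  proof (induction ps')
    case (Cons p ps')
    have "complete_on ?R' {x \<in> set ps' \<union> (set vs \<union> {}). (p, x) \<in> ?R'}"
    proof (rule pairwiseI)
      fix x y assume "x \<in> {x \<in> set ps' \<union> (set vs \<union> {}). (p, x) \<in> ?R'}"
        "y \<in> {x \<in> set ps' \<union> (set vs \<union> {}). (p, x) \<in> ?R'}" "x \<noteq> y"
      then show "(x, y) \<in> ?R'"
        using priv[of p x] priv[of p y] Cons.prems by (auto simp: share_bag_def)
    qed
    then show ?case using Cons by simp
  qed simp
  moreover have "perfect_elim ?R' {} vs"
  proof (rule perfect_elim_transfer[OF vs(3)])
    fix v x assume "v \<in> set vs" "x \<in> set vs \<union> {}" "(v, x) \<in> ?R'"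
    then have "(v, x) \<in> ?R" using agree[of v x] vs(2) by simp
    then show "(v, x) \<in> ?R \<and> (x \<in> {} \<longrightarrow> x \<in> {})" by simp
  next
    fix x y assume "(x, y) \<in> ?R"
    then show "(x, y) \<in> ?R'" by (auto simp: share_bag_def)
  qed
  ultimately have "perfect_elim ?R' {} (ps @ vs)"
    by (simp add: perfect_elim_append)
  moreover have "distinct (ps @ vs)" "set (ps @ vs) = (\<Union>t\<in>set (t # ts). B t)"
    using ps vs by auto
  moreover have "\<exists>t\<in>set (t # ts). Q \<subseteq> B t"
    if Q: "Q \<noteq> {}" "Q \<subseteq> set (ps @ vs)" "complete_on ?R' Q" for Q
  proof (cases "Q \<subseteq> set vs")
    case True
    have "complete_on ?R Q"
    proof (rule pairwiseI)
      fix x y assume xy: "x \<in> Q" "y \<in> Q" "x \<noteq> y"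
      then have "(x, y) \<in> ?R'" using pairwiseD[OF Q(3)] by blast
      then show "(x, y) \<in> ?R" using agree[of x y] True xy vs(2) by blast
    qed
    then show ?thesis using cliques Q(1) True by auto
  next
    case False
    then obtain p where p: "p \<in> Q" "p \<in> set ps" using Q(2) by auto
    have "x \<in> B t" if "x \<in> Q" for x
      using that p priv[of p x] ps(1) Q(3) by (cases "x = p") (auto simp: pairwise_def)
    then show ?thesis by auto
  qed
  ultimately show ?case by blast
qed

text \<open>
  A graph without cycles is trivially chordal, so the ordering of the tree that
  \<open>perfect_elim_share_bag\<close> requires is provided by \<open>chordal_iff_perfect_elim\<close>.
\<close>

lemma clique_chordal_supergraph_if_small_bags:
  assumes G: "pair_graph G" and td: "tree_decomposition G T B"
    and w: "\<And>t. t \<in> pverts T \<Longrightarrow> card (B t) \<le> m"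
  shows "\<exists>G'. clique_chordal_supergraph m G G'"
proof -
  note g = pair_graphD[OF G]
  have T: "pair_graph T" and acyclic: "\<nexists>c. graph_cycle T c"
    and bags: "\<And>t. t \<in> pverts T \<Longrightarrow> B t \<subseteq> pverts G"
    and edges: "\<And>u v. (u, v) \<in> parcs G \<Longrightarrow> \<exists>t\<in>pverts T. u \<in> B t \<and> v \<in> B t"
    and conn: "\<And>v. v \<in> pverts G \<Longrightarrow>
      Digraph_Component.connected (with_proj T \<restriction> {t \<in> pverts T. v \<in> B t})"
    using td by (auto simp: tree_decomposition_def undirected_tree_def)
  note t = pair_graphD[OF T]
  have conn: "{t \<in> pverts T. v \<in> B t} \<noteq> {}"
    "\<And>s t. s \<in> pverts T \<Longrightarrow> t \<in> pverts T \<Longrightarrow> v \<in> B s \<Longrightarrow> v \<in> B t \<Longrightarrow>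
      (s, t) \<in> rtrancl_on {t \<in> pverts T. v \<in> B t} (parcs T)" if "v \<in> pverts G" for v
    using conn[OF that] connected_induce_iff[OF T, of "{t \<in> pverts T. v \<in> B t}"] by auto
  have "chordal T" using acyclic by (simp add: chordal_def)
  then obtain ts where ts: "distinct ts" "set ts = pverts T" "perfect_elim (parcs T) {} ts"
    using chordal_iff_perfect_elim[OF T] by blast
  have triangle: False if "(x, y) \<in> parcs T" "(y, z) \<in> parcs T" "(x, z) \<in> parcs T" for x y z
  proof -
    have "x \<noteq> y" "y \<noteq> z" "x \<noteq> z" using that t(8) by auto
    moreover have "(z, x) \<in> parcs T" using that(3) by (rule t(7))
    ultimately have "graph_cycle T [x, y, z]"
      using that t(5,6) by (auto simp: graph_cycle_def less_Suc_eq)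
    then show False using acyclic by blast
  qed
  have "\<exists>vs. distinct vs \<and> set vs = (\<Union>t\<in>set ts. B t) \<and>
    perfect_elim (share_bag B (set ts)) {} vs \<and>
    (\<forall>Q. Q \<noteq> {} \<longrightarrow> Q \<subseteq> set vs \<longrightarrow> complete_on (share_bag B (set ts)) Q \<longrightarrow> (\<exists>t\<in>set ts. Q \<subseteq> B t))"
  proof (rule perfect_elim_share_bag[OF t(3,4) ts(1,3) triangle])
    show "finite (B s)" if "s \<in> set ts" for s
      using bags[of s] that ts(2) g(1) finite_subset by blast
    show "(s, t) \<in> rtrancl_on {t \<in> set ts. v \<in> B t} (parcs T)"
      if "s \<in> set ts" "t \<in> set ts" "v \<in> B s" "v \<in> B t" for v s t
      using that bags[of s] conn(2)[of v s t] unfolding ts(2) by blast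
  qed
  then obtain vs where vs: "set vs = (\<Union>t\<in>pverts T. B t)" "perfect_elim (share_bag B (pverts T)) {} vs"
    and cliques: "\<And>Q. Q \<noteq> {} \<Longrightarrow> Q \<subseteq> set vs \<Longrightarrow> complete_on (share_bag B (pverts T)) Q \<Longrightarrow>
      \<exists>t\<in>pverts T. Q \<subseteq> B t"
    unfolding ts(2) by metis
  have V: "set vs = pverts G" using vs(1) bags conn(1) by blast
  define H where "H = \<lparr>pverts = pverts G, parcs = share_bag B (pverts T)\<rparr>"
  have H: "pair_graph H"
    using g(1) bags unfolding H_def pair_graph_iff by (auto simp: share_bag_def sym_def irrefl_def)
  moreover have "chordal H"
    by (rule chordal_if_perfect_elim[OF H, of vs]) (use V vs(2) in \<open>simp_all add: H_def\<close>)
  moreover have "parcs G \<subseteq> parcs H"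
    using edges g(8) by (fastforce simp: H_def share_bag_def)
  moreover have False if "clique H Q" "card Q = m + 1" for Q
  proof -
    have "Q \<noteq> {}" using that(2) by auto
    moreover have "Q \<subseteq> set vs" "complete_on (share_bag B (pverts T)) Q"
      using that(1) V by (auto simp: clique_iff H_def)
    ultimately obtain s where s: "s \<in> pverts T" "Q \<subseteq> B s" using cliques by blast
    have "finite (B s)" using bags[OF s(1)] g(1) finite_subset by blast
    then have "card Q \<le> m" using card_mono[OF _ s(2)] w[OF s(1)] by simp
    then show False using that(2) by simp
  qed
  ultimately show ?thesis
    unfolding clique_chordal_supergraph_def by (intro exI[of _ H]) (auto simp: H_def)
qed

section \<open>From chordal supergraphs to tree decompositions\<close>

text \<open>
  A tree decomposition of the graph on \<open>V\<close> with edges \<open>E\<close> whose bags are cliques. That all cliques,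
  rather than just the edges, lie in bags is what makes the inductive construction possible.
\<close>

definition clique_tree :: "'a rel \<Rightarrow> 'a set \<Rightarrow> 'b pair_pre_digraph \<Rightarrow> ('b \<Rightarrow> 'a set) \<Rightarrow> bool" where
  "clique_tree E V T B \<longleftrightarrow> undirected_tree T \<and>
     (\<forall>t\<in>pverts T. B t \<subseteq> V \<and> complete_on E (B t)) \<and>
     (\<forall>Q\<subseteq>V. complete_on E Q \<longrightarrow> (\<exists>t\<in>pverts T. Q \<subseteq> B t)) \<and>
     (\<forall>v\<in>V. Digraph_Component.connected (with_proj T \<restriction> {t \<in> pverts T. v \<in> B t}))"

lemma clique_treeD:
  assumes "clique_tree E V T B"
  shows "undirected_tree T"
    and "t \<in> pverts T \<Longrightarrow> B t \<subseteq> V"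
    and "t \<in> pverts T \<Longrightarrow> complete_on E (B t)"
    and "Q \<subseteq> V \<Longrightarrow> complete_on E Q \<Longrightarrow> \<exists>t\<in>pverts T. Q \<subseteq> B t"
    and "v \<in> V \<Longrightarrow> Digraph_Component.connected (with_proj T \<restriction> {t \<in> pverts T. v \<in> B t})"
  using assms by (simp_all add: clique_tree_def)

text \<open>
  When a vertex \<open>v\<close> is put in front of the ordering, its later neighbours form a clique, which lies
  in the bag of some node \<open>t\<close>. A new leaf at \<open>t\<close> gets \<open>v\<close> and these neighbours as its bag. The tree
  for the empty ordering is a single node with an empty bag, so that there is a \<open>t\<close> also for a
  vertex without later neighbours.
\<close>

lemma ex_clique_tree:
  assumes "sym E" "distinct vs" "perfect_elim E {} vs"
  shows "\<exists>(T :: nat pair_pre_digraph) B. clique_tree E (set vs) T B"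
  using assms(2,3)
proof (induction vs)
  case Nil
  show ?case
    by (intro exI[of _ "\<lparr>pverts = {0}, parcs = {}\<rparr>"] exI[of _ "\<lambda>_. {}"])
      (simp add: clique_tree_def undirected_tree_single)
next
  case (Cons v vs)
  let ?N = "{x \<in> set vs. (v, x) \<in> E}"
  have sym: "(y, x) \<in> E" if "(x, y) \<in> E" for x y using assms(1) that by (rule symD)
  have v: "v \<notin> set vs" and N: "complete_on E ?N" using Cons.prems by auto
  obtain T :: "nat pair_pre_digraph" and B where TB: "clique_tree E (set vs) T B"
    using Cons.IH Cons.prems by auto
  note T = clique_treeD(1)[OF TB] and bags = clique_treeD(2,3)[OF TB]
    and cliques = clique_treeD(4)[OF TB] and conn = clique_treeD(5)[OF TB]
  obtain t where t: "t \<in> pverts T" "?N \<subseteq> B t" using cliques[OF _ N] by blast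
  have pT: "pair_graph T" using T by (simp add: undirected_tree_def)
  obtain n where n: "n \<notin> pverts T"
    using ex_new_if_finite[OF infinite_UNIV_nat pair_graphD(1)[OF pT]] by blast
  define T' where "T' = \<lparr>pverts = insert n (pverts T), parcs = parcs T \<union> {(n, t), (t, n)}\<rparr>"
  define B' where "B' = B(n := insert v ?N)"
  have T': "undirected_tree T'"
    unfolding T'_def by (rule undirected_tree_add_leaf[OF T t(1) n])
  then have pT': "pair_graph T'" by (simp add: undirected_tree_def)
  have B'n: "B' n = insert v ?N" and B'o: "\<And>s. s \<in> pverts T \<Longrightarrow> B' s = B s"
    using n by (auto simp: B'_def)
  have VT': "pverts T' = insert n (pverts T)" and ET': "parcs T' = parcs T \<union> {(n, t), (t, n)}"
    by (simp_all add: T'_def)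
  have clique_N: "complete_on E (insert v ?N)"
    using N sym by (auto simp: pairwise_insert)
  have "B' s \<subseteq> set (v # vs) \<and> complete_on E (B' s)" if "s \<in> pverts T'" for s
  proof (cases "s = n")
    case True
    then show ?thesis using clique_N unfolding True B'n by auto
  next
    case False
    then have "s \<in> pverts T" using that VT' by blast
    then show ?thesis using bags[of s] B'o[of s] by auto
  qed
  moreover have "\<exists>s\<in>pverts T'. Q \<subseteq> B' s" if Q: "Q \<subseteq> set (v # vs)" "complete_on E Q" for Q
  proof (cases "v \<in> Q")
    case True
    have "Q \<subseteq> insert v ?N"
    proof
      fix x assume "x \<in> Q"
      then show "x \<in> insert v ?N" using pairwiseD[OF Q(2) True] Q(1) by (cases "x = v") auto
    qed
    then show ?thesis unfolding VT' B'n[symmetric] by blast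
  next
    case False
    then obtain s where "s \<in> pverts T" "Q \<subseteq> B s" using Q cliques[of Q] by auto
    then show ?thesis unfolding VT' using B'o by blast
  qed
  moreover have "Digraph_Component.connected (with_proj T' \<restriction> {s \<in> pverts T'. u \<in> B' s})"
    if u: "u \<in> set (v # vs)" for u
  proof -
    let ?S = "{s \<in> pverts T. u \<in> B s}" and ?S' = "{s \<in> pverts T'. u \<in> B' s}"
    have conn': "?S \<noteq> {} \<and> (\<forall>x\<in>?S. \<forall>y\<in>?S. (x, y) \<in> rtrancl_on ?S (parcs T))" if "u \<in> set vs"
      using conn[OF that] connected_induce_iff[OF pT, of ?S] by blast
    have "?S' \<noteq> {} \<and> (\<forall>x\<in>?S'. \<forall>y\<in>?S'. (x, y) \<in> rtrancl_on ?S' (parcs T'))"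
    proof (cases "u = v")
      case True
      have "u \<notin> B' s" if "s \<in> pverts T" for s using bags(1)[OF that] B'o[OF that] v True by auto
      then have "?S' = {n}" using True B'n VT' by auto
      then show ?thesis by simp
    next
      case False
      then have uvs: "u \<in> set vs" using u by simp
      have mono: "(x, y) \<in> rtrancl_on ?S' (parcs T')" if "x \<in> ?S" "y \<in> ?S" for x y
      proof (rule rtrancl_on_mono)
        show "(x, y) \<in> rtrancl_on ?S (parcs T)" using conn'[OF uvs] that by blast
        show "parcs T \<subseteq> parcs T'" unfolding ET' by blast
        show "?S \<subseteq> ?S'" unfolding VT' using B'o by blast
      qed
      show ?thesis
      proof (cases "u \<in> ?N")
        case True
        then have tS: "t \<in> ?S" using t by blast
        have S': "?S' = insert n ?S"
          unfolding VT' using True B'n B'o by blast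
        have nt: "(n, t) \<in> parcs T'" "(t, n) \<in> parcs T'" by (simp_all add: ET')
        have to_t: "(x, t) \<in> rtrancl_on ?S' (parcs T')" if "x \<in> ?S'" for x
        proof (cases "x = n")
          case True
          have "(n, t) \<in> rtrancl_on ?S' (parcs T')"
            by (rule converse_rtrancl_on_into_rtrancl_on[OF nt(1) mono[OF tS tS]])
              (simp only: S' insertI1)
          then show ?thesis using True by simp
        next
          case False
          then have "x \<in> ?S" using that unfolding S' by blast
          then show ?thesis using mono tS by blast
        qed
        have "sym (rtrancl_on ?S' (parcs T'))"
          by (rule rtrancl_on_sym[OF pair_graphD(3)[OF pT']])
        then have from_t: "(t, y) \<in> rtrancl_on ?S' (parcs T')" if "y \<in> ?S'" for y
          using to_t[OF that] by (rule symD)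
        have "(x, y) \<in> rtrancl_on ?S' (parcs T')" if "x \<in> ?S'" "y \<in> ?S'" for x y
          by (rule rtrancl_on_trans[OF to_t[OF that(1)] from_t[OF that(2)]])
        moreover have "?S' \<noteq> {}" unfolding S' by blast
        ultimately show ?thesis by blast
      next
        case False
        then have "?S' = ?S"
          unfolding VT' using B'n B'o n \<open>u \<noteq> v\<close> by auto
        then show ?thesis using mono conn'[OF uvs] by auto
      qed
    qed
    then show ?thesis
      using connected_induce_iff[OF pT', of ?S'] by blast
  qed
  ultimately have "clique_tree E (set (v # vs)) T' B'"
    using T' unfolding clique_tree_def by blast
  then show ?case by blast
qed

lemma tree_decomposition_if_perfect_elim:
  assumes "sym E" "distinct vs" "perfect_elim E {} vs" "set vs = pverts G"
    and "parcs G \<subseteq> E" "pair_graph G"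
  shows "\<exists>(T :: nat pair_pre_digraph) B. tree_decomposition G T B \<and>
    (\<forall>t\<in>pverts T. complete_on E (B t))"
proof -
  obtain T :: "nat pair_pre_digraph" and B where TB: "clique_tree E (pverts G) T B"
    using ex_clique_tree[OF assms(1-3)] unfolding assms(4) by blast
  have "\<exists>t\<in>pverts T. u \<in> B t \<and> v \<in> B t" if "(u, v) \<in> parcs G" for u v
  proof -
    have "(u, v) \<in> E" "(v, u) \<in> E" using that assms(1,5) by (auto dest: symD)
    then have "complete_on E {u, v}" by (auto simp: pairwise_def)
    moreover have "{u, v} \<subseteq> pverts G"
      using pair_graphD(5,6)[OF assms(6) that] by simp
    ultimately show ?thesis using clique_treeD(4)[OF TB, of "{u, v}"] by simp
  qed
  then have "tree_decomposition G T B"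
    using clique_treeD(1,2,5)[OF TB] unfolding tree_decomposition_def by auto
  then show ?thesis using clique_treeD(3)[OF TB] by blast
qed

lemma decomposition_width_le_iff:
  assumes "tree_decomposition G T B"
  shows "decomposition_width T B \<le> w \<longleftrightarrow> (\<forall>t\<in>pverts T. card (B t) \<le> w + 1)"
proof -
  have T: "pair_graph T" "Digraph_Component.connected (with_proj T)"
    using assms by (auto simp: tree_decomposition_def undirected_tree_def)
  have "finite (pverts T)" "pverts T \<noteq> {}"
    using pair_graphD(1)[OF T(1)] T(2) connected_iff[OF T(1)] by blast+
  then have "Max ((\<lambda>t. card (B t)) ` pverts T) \<le> w + 1 \<longleftrightarrow> (\<forall>t\<in>pverts T. card (B t) \<le> w + 1)"
    by simp
  then show ?thesis by (simp add: decomposition_width_def le_diff_conv)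
qed

text \<open>
  The least width is attained because some tree decomposition exists: every ordering eliminates the
  complete graph, for which \<open>UNIV\<close> serves as edge relation.
\<close>

lemma treewidth_attained:
  assumes "pair_graph G"
  shows "\<exists>(T :: nat pair_pre_digraph) B. tree_decomposition G T B \<and>
    decomposition_width T B = treewidth G"
proof -
  obtain vs where vs: "distinct vs" "set vs = pverts G"
    using finite_distinct_list[OF pair_graphD(1)[OF assms]] by blast
  have "perfect_elim UNIV {} vs"
    by (rule perfect_elimI_nth) simp
  then obtain T :: "nat pair_pre_digraph" and B where "tree_decomposition G T B"
    using tree_decomposition_if_perfect_elim[of UNIV vs G] vs assms by (auto simp: sym_def)
  then have "\<exists>w (T :: nat pair_pre_digraph) B. tree_decomposition G T B \<and> w = decomposition_width T B"
    by blast
  then have "\<exists>(T :: nat pair_pre_digraph) B. tree_decomposition G T B \<and>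
    treewidth G = decomposition_width T B"
    unfolding treewidth_def by (rule LeastI_ex)
  then show ?thesis by metis
qed

lemma clique_chordal_supergraph_if_treewidth_le:
  assumes "pair_graph G" "treewidth G \<le> k"
  shows "\<exists>G'. clique_chordal_supergraph (k + 1) G G'"
proof -
  obtain T :: "nat pair_pre_digraph" and B where td: "tree_decomposition G T B"
      "decomposition_width T B = treewidth G"
    using treewidth_attained[OF assms(1)] by blast
  then have "\<forall>t\<in>pverts T. card (B t) \<le> k + 1"
    using decomposition_width_le_iff[OF td(1), of k] assms(2) by simp
  then show ?thesis
    using clique_chordal_supergraph_if_small_bags[OF assms(1) td(1)] by blast
qed

lemma treewidth_le_if_small_cliques:
  assumes G: "pair_graph G" and ch: "clique_chordal_supergraph m G G'"
    and small: "\<And>K. clique G' K \<Longrightarrow> card K \<le> k + 1"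
  shows "treewidth G \<le> k"
proof -
  have G': "pair_graph G'" "pverts G = pverts G'" "parcs G \<subseteq> parcs G'" "chordal G'"
    using ch by (auto simp: clique_chordal_supergraph_def)
  obtain vs where vs: "distinct vs" "set vs = pverts G'" "perfect_elim (parcs G') {} vs"
    using G'(4) chordal_iff_perfect_elim[OF G'(1)] by blast
  have "set vs = pverts G" using vs(2) G'(2) by simp
  then obtain T :: "nat pair_pre_digraph" and B where td: "tree_decomposition G T B"
    and bags: "\<forall>t\<in>pverts T. complete_on (parcs G') (B t)"
    using tree_decomposition_if_perfect_elim[OF pair_graphD(3)[OF G'(1)] vs(1,3) _ G'(3) G] by blast
  have "card (B t) \<le> k + 1" if "t \<in> pverts T" for t
    using that bags td G'(2) by (intro small) (auto simp: clique_iff tree_decomposition_def)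
  then have "decomposition_width T B \<le> k"
    using decomposition_width_le_iff[OF td] by blast
  moreover have "treewidth G \<le> decomposition_width T B"
    unfolding treewidth_def using td by (intro Least_le) blast
  ultimately show ?thesis by simp
qed

section \<open>Decomposition along clique separators\<close>

text \<open>
  Induction along an ordering that leaves the clique \<open>K\<close> to the end. The last assumption says that
  \<open>K\<close> is a maximal clique. If only \<open>v\<close> is outside of \<open>K\<close>, the sides are \<open>K\<close> and the closed
  neighbourhood of \<open>v\<close>, which by maximality does not contain \<open>K\<close>. Otherwise take a separation of
  the graph without \<open>v\<close>: the neighbours of \<open>v\<close> form a clique, hence lie in one side, and \<open>v\<close> is
  added to this side.
\<close>

lemma ex_separation_in_maximal_clique:
  assumes "perfect_elim E K vs" "sym E" "irrefl E" "distinct vs" "set vs \<inter> K = {}" "vs \<noteq> []"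
    and "complete_on E K" "\<And>v. v \<in> set vs \<Longrightarrow> \<exists>x\<in>K. (v, x) \<notin> E"
  shows "\<exists>A B. A \<union> B = set vs \<union> K \<and> A \<inter> B \<subseteq> K \<and> A - B \<noteq> {} \<and> B - A \<noteq> {} \<and>
    (\<forall>a\<in>A - B. \<forall>b\<in>B - A. (a, b) \<notin> E)"
  using assms
proof (induction vs)
  case (Cons v vs)
  let ?N = "{x \<in> set vs \<union> K. (v, x) \<in> E}"
  have N: "complete_on E ?N" using Cons.prems(1) by simp
  have sym: "(b, a) \<in> E" if "(a, b) \<in> E" for a b using Cons.prems(2) that by (auto dest: symD)
  have v: "v \<notin> set vs" "v \<notin> K" using Cons.prems(4,5) by auto
  show ?case
  proof (cases "vs = []")
    case True
    obtain x where "x \<in> K" "(v, x) \<notin> E" using Cons.prems(8) by auto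
    then show ?thesis
      using True v sym by (intro exI[of _ K] exI[of _ "insert v ?N"]) auto
  next
    case False
    have "\<exists>A B. A \<union> B = set vs \<union> K \<and> A \<inter> B \<subseteq> K \<and> A - B \<noteq> {} \<and> B - A \<noteq> {} \<and>
        (\<forall>a\<in>A - B. \<forall>b\<in>B - A. (a, b) \<notin> E)"
      using Cons.prems False by (intro Cons.IH) auto
    then obtain A B where AB: "A \<union> B = set vs \<union> K" "A \<inter> B \<subseteq> K" "A - B \<noteq> {}" "B - A \<noteq> {}"
        and sep: "\<forall>a\<in>A - B. \<forall>b\<in>B - A. (a, b) \<notin> E"
      by blast
    have "?N \<subseteq> A \<or> ?N \<subseteq> B"
    proof (rule ccontr)
      assume "\<not> (?N \<subseteq> A \<or> ?N \<subseteq> B)"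
      then obtain a b where ab: "a \<in> ?N" "b \<in> ?N" "a \<notin> B" "b \<notin> A" by blast
      then have "a \<in> A - B" "b \<in> B - A" using AB(1) by auto
      moreover have "(a, b) \<in> E" using pairwiseD[OF N ab(1,2)] ab(3) calculation by blast
      ultimately show False using sep by blast
    qed
    have vAB: "v \<notin> A" "v \<notin> B" using v AB(1) by auto
    from \<open>?N \<subseteq> A \<or> ?N \<subseteq> B\<close> show ?thesis
    proof
      assume "?N \<subseteq> A"
      then have "(v, b) \<notin> E" if "b \<in> B - A" for b using that AB(1) by blast
      then show ?thesis
        using AB vAB sep by (intro exI[of _ "insert v A"] exI[of _ B]) auto
    next
      assume "?N \<subseteq> B"
      then have "(a, v) \<notin> E" if "a \<in> A - B" for a using that AB(1) sym by blast
      then show ?thesis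
        using AB vAB sep by (intro exI[of _ A] exI[of _ "insert v B"]) auto
    qed
  qed
qed simp

lemma is_clique_sum_of_separation:
  assumes "pair_graph G" "pverts G = A \<union> B" "clique G (A \<inter> B)"
    and "\<And>a b. a \<in> A - B \<Longrightarrow> b \<in> B - A \<Longrightarrow> (a, b) \<notin> parcs G"
  shows "is_clique_sum (induced G A) (induced G B) G"
proof -
  note g = pair_graphD[OF assms(1)]
  have "parcs G = parcs G \<inter> A \<times> A \<union> parcs G \<inter> B \<times> B"
  proof
    show "parcs G \<subseteq> parcs G \<inter> A \<times> A \<union> parcs G \<inter> B \<times> B"
    proof
      fix e assume e: "e \<in> parcs G"
      obtain u v where uv: "e = (u, v)" by (cases e)
      have "(u, v) \<in> parcs G" "(v, u) \<in> parcs G" using e uv g(7) by auto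
      moreover have "u \<in> A \<union> B" "v \<in> A \<union> B" using g(5,6) e uv assms(2) by auto
      ultimately have "u \<in> A \<and> v \<in> A \<or> u \<in> B \<and> v \<in> B"
        using assms(4)[of u v] assms(4)[of v u] by blast
      then show "e \<in> parcs G \<inter> A \<times> A \<union> parcs G \<inter> B \<times> B" using e uv by blast
    qed
  qed blast
  moreover have "clique (induced G A) (A \<inter> B)" "clique (induced G B) (A \<inter> B)"
    using assms(3) by (auto simp: clique_iff pairwise_def)
  ultimately show ?thesis
    unfolding is_clique_sum_def using assms(2)
    by (intro exI[of _ "A \<inter> B"] exI[of _ "\<lambda>x. x"]) (simp add: map_prod.identity bij_betw_def; blast)
qed

lemma clique_chordal_supergraph_induced:
  assumes "clique_chordal_supergraph m G G'" "A \<subseteq> pverts G"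
  shows "clique_chordal_supergraph m (induced G A) (induced G' A)"
proof -
  have G': "pair_graph G'" "pverts G = pverts G'" "parcs G \<subseteq> parcs G'" "chordal G'"
    and cl: "\<And>K. clique G' K \<Longrightarrow> card K = m + 1 \<Longrightarrow> clique G K"
    using assms(1) by (auto simp: clique_chordal_supergraph_def)
  have A: "A \<subseteq> pverts G'" using assms(2) G'(2) by simp
  have "clique (induced G A) K" if K: "clique (induced G' A) K" "card K = m + 1" for K
  proof -
    have "clique G' K" "K \<subseteq> A" using K(1) A by (auto simp: clique_def)
    then have "clique G K" using cl K(2) by blast
    then show ?thesis using \<open>K \<subseteq> A\<close> by (auto simp: clique_def)
  qed
  moreover have "parcs (induced G A) \<subseteq> parcs (induced G' A)" using G'(3) by auto
  ultimately show ?thesis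
    using pair_graph_induced[OF G'(1) A] chordal_induced[OF G'(4) A]
    unfolding clique_chordal_supergraph_def by simp
qed

text \<open>
  Induction on the number of vertices. If \<open>G\<close> is neither complete nor of treewidth at most \<open>k\<close>, the
  supergraph has a clique with at least \<open>k + 2\<close> vertices. A largest clique \<open>K\<close> of the
  supergraph is then a clique of \<open>G\<close>, and it does not contain all vertices. So the separation
  inside of \<open>K\<close> has two proper sides, which inherit the supergraph.
\<close>

lemma clique_sum_of_if_clique_chordal_supergraph:
  assumes "pair_graph G" "clique_chordal_supergraph (k + 1) G G'"
  shows "\<exists>M. clique_sum_of M G \<and> (\<forall>H\<in>#M. clique H (pverts H) \<or> treewidth H \<le> k)"
  using assms
proof (induction "card (pverts G)" arbitrary: G G' rule: less_induct)
  case less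
  have G': "pair_graph G'" "pverts G = pverts G'" "parcs G \<subseteq> parcs G'" "chordal G'"
    and cl: "\<And>K. clique G' K \<Longrightarrow> card K = k + 2 \<Longrightarrow> clique G K"
    using less.prems(2) by (auto simp: clique_chordal_supergraph_def)
  note g = pair_graphD[OF less.prems(1)] and g' = pair_graphD[OF G'(1)]
  have big: "clique G K" if "clique G' K" "k + 2 \<le> card K" for K
  proof (rule clique_if_small_subsets_cliques)
    show "clique G L" if "L \<subseteq> K" "card L = k + 2" for L
      using cl clique_subset \<open>clique G' K\<close> that by blast
  qed (use that in simp_all)
  show ?case
  proof (cases "clique G (pverts G) \<or> treewidth G \<le> k")
    case True
    then show ?thesis
      using clique_sum_of.single[OF less.prems(1)] by (intro exI[of _ "{#G#}"]) simp
  next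
    case False
    have "\<exists>Q. clique G' Q \<and> k + 2 \<le> card Q"
    proof (rule ccontr)
      assume *: "\<not> (\<exists>Q. clique G' Q \<and> k + 2 \<le> card Q)"
      have "card K \<le> k + 1" if "clique G' K" for K
      proof (rule ccontr)
        assume "\<not> card K \<le> k + 1"
        then have "k + 2 \<le> card K" by simp
        then show False using * that by blast
      qed
      then show False
        using treewidth_le_if_small_cliques[OF less.prems] False by blast
    qed
    then obtain Q where Q: "clique G' Q" "k + 2 \<le> card Q" by blast
    have bounded: "card K \<le> card (pverts G')" if "clique G' K" for K
      using that card_mono[OF g'(1)] by (simp add: clique_iff)
    have "\<exists>K. clique G' K \<and> (\<forall>L. clique G' L \<longrightarrow> card L \<le> card K)"
    proof (rule ex_has_greatest_nat[of "clique G'" Q card "Suc (card (pverts G'))"])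
      show "clique G' Q" by (rule Q(1))
      show "\<forall>L. clique G' L \<longrightarrow> card L < Suc (card (pverts G'))"
        using bounded by (simp add: less_Suc_eq_le)
    qed
    then obtain K where K: "clique G' K" and K_max: "\<And>L. clique G' L \<Longrightarrow> card L \<le> card K"
      by blast
    have KG: "clique G K" using big[OF K] K_max[OF Q(1)] Q(2) by simp
    have KV: "K \<subseteq> pverts G'" "complete_on (parcs G') K" using K by (auto simp: clique_iff)
    have "finite K" using KV(1) g'(1) finite_subset by blast
    obtain vs where vs: "distinct vs" "set vs = pverts G' - K" "perfect_elim (parcs G') K vs"
      using ex_perfect_elim_if_chordal[OF G'(1,4) K] by blast
    have no_dominating: "\<exists>x\<in>K. (v, x) \<notin> parcs G'" if "v \<in> set vs" for v
    proof (rule ccontr)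
      assume "\<not> (\<exists>x\<in>K. (v, x) \<notin> parcs G')"
      then have "clique G' (insert v K)"
        using that vs(2) KV g'(7) by (auto simp: clique_iff pairwise_insert)
      then show False
        using K_max[of "insert v K"] that vs(2) \<open>finite K\<close> by simp
    qed
    have "vs \<noteq> []" using False KG KV(1) vs(2) G'(2) by auto
    then obtain A B where AB: "A \<union> B = set vs \<union> K" "A \<inter> B \<subseteq> K" "A - B \<noteq> {}" "B - A \<noteq> {}"
      and sep: "\<forall>a\<in>A - B. \<forall>b\<in>B - A. (a, b) \<notin> parcs G'"
      using ex_separation_in_maximal_clique[OF vs(3) g'(3,4) vs(1) _ _ KV(2) no_dominating] vs(2)
      by blast
    have V: "pverts G = A \<union> B" using AB(1) vs(2) KV(1) G'(2) by blast
    have part: "\<exists>M. clique_sum_of M (induced G C) \<and>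
        (\<forall>H\<in>#M. clique H (pverts H) \<or> treewidth H \<le> k)" if "C \<subset> pverts G" for C
    proof (rule less.hyps)
      show "card (pverts (induced G C)) < card (pverts G)"
        using psubset_card_mono[OF g(1) that] by simp
      show "pair_graph (induced G C)"
        using pair_graph_induced[OF less.prems(1)] that by blast
      show "clique_chordal_supergraph (k + 1) (induced G C) (induced G' C)"
        using clique_chordal_supergraph_induced[OF less.prems(2)] that by blast
    qed
    obtain M1 where M1: "clique_sum_of M1 (induced G A)"
        "\<forall>H\<in>#M1. clique H (pverts H) \<or> treewidth H \<le> k"
      using part[of A] AB V by blast
    obtain M2 where M2: "clique_sum_of M2 (induced G B)"
        "\<forall>H\<in>#M2. clique H (pverts H) \<or> treewidth H \<le> k"
      using part[of B] AB V by blast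
    have "is_clique_sum (induced G A) (induced G B) G"
      using sep G'(3) clique_subset[OF KG AB(2)]
      by (intro is_clique_sum_of_separation[OF less.prems(1) V]) blast+
    then have "clique_sum_of (M1 + M2) G"
      by (rule clique_sum_of.sum[OF M1(1) M2(1)])
    then show ?thesis using M1(2) M2(2) by (intro exI[of _ "M1 + M2"]) auto
  qed
qed

section \<open>The equivalence\<close>

lemma complete_digraph_iff:
  fixes G :: "'a pair_pre_digraph"
  assumes "pair_graph G"
  shows "(\<exists>n. complete_digraph n (with_proj G)) \<longleftrightarrow> clique G (pverts G)"
proof -
  have "graph (with_proj G)" by (rule pair_graph.pair_graphD_graph[OF assms])
  moreover have "parcs G = {(u, v). (u, v) \<in> pverts G \<times> pverts G \<and> u \<noteq> v} \<longleftrightarrow> clique G (pverts G)"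
  proof
    assume "parcs G = {(u, v). (u, v) \<in> pverts G \<times> pverts G \<and> u \<noteq> v}"
    then show "clique G (pverts G)" unfolding clique_def by blast
  next
    assume c: "clique G (pverts G)"
    show "parcs G = {(u, v). (u, v) \<in> pverts G \<times> pverts G \<and> u \<noteq> v}"
    proof (rule set_eqI)
      fix e :: "'a \<times> 'a"
      obtain u v where e: "e = (u, v)" by (cases e)
      show "e \<in> parcs G \<longleftrightarrow> e \<in> {(u, v). (u, v) \<in> pverts G \<times> pverts G \<and> u \<noteq> v}"
        using pair_graphD(5,6)[OF assms, of u v] pair_graphD(8)[OF assms, of u] c
        unfolding e clique_def by auto
    qed
  qed
  ultimately show ?thesis by (simp add: complete_digraph_def)
qed

lemma clique_chordal_supergraph_of_clique:
  assumes "pair_graph G" "clique G (pverts G)"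
  shows "clique_chordal_supergraph m G G"
proof -
  obtain vs where vs: "distinct vs" "set vs = pverts G"
    using finite_distinct_list[OF pair_graphD(1)[OF assms(1)]] by blast
  have "perfect_elim (parcs G) {} vs"
  proof (rule perfect_elimI_nth)
    fix j l assume jl: "j < length vs" "l < length vs" "j \<noteq> l"
    then have "vs ! j \<noteq> vs ! l" using vs(1) by (simp add: nth_eq_iff_index_eq)
    then show "(vs ! j, vs ! l) \<in> parcs G"
      using assms(2) nth_mem[OF jl(1)] nth_mem[OF jl(2)] unfolding vs(2) clique_def by blast
  qed
  then have "chordal G" by (rule chordal_if_perfect_elim[OF assms(1) vs(2)])
  then show ?thesis
    using assms(1) by (simp add: clique_chordal_supergraph_def)
qed

lemma clique_sum_of_pair_graph:
  assumes "clique_sum_of M G" "H \<in># M"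
  shows "pair_graph H"
  using assms by (induction rule: clique_sum_of.induct) auto

theorem theorem1p2:
  fixes G :: "'a pair_pre_digraph" and k :: nat
  assumes "k \<ge> 1" and "pair_graph G"
  shows "((\<exists>M. clique_sum_of M G \<and>
              (\<forall>H\<in>#M. (\<exists>n. complete_digraph n (with_proj H)) \<or> treewidth H \<le> k))
            \<longleftrightarrow> (\<exists>\<pi>. blended_elimination_ordering k G \<pi>))
       \<and> ((\<exists>\<pi>. blended_elimination_ordering k G \<pi>)
            \<longleftrightarrow> (\<exists>G'. clique_chordal_supergraph (k + 1) G G'))"
proof -
  have blended: "(\<exists>\<pi>. blended_elimination_ordering k G \<pi>)
      \<longleftrightarrow> (\<exists>G'. clique_chordal_supergraph (k + 1) G G')"
    using blended_ordering_if_clique_chordal_supergraph[of k G]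
      clique_chordal_supergraph_fill_in[OF assms(2)] by blast
  have "(\<exists>M. clique_sum_of M G \<and>
        (\<forall>H\<in>#M. (\<exists>n. complete_digraph n (with_proj H)) \<or> treewidth H \<le> k))
      \<longleftrightarrow> (\<exists>M. clique_sum_of M G \<and> (\<forall>H\<in>#M. clique H (pverts H) \<or> treewidth H \<le> k))"
    using clique_sum_of_pair_graph complete_digraph_iff by metis
  also have "\<dots> \<longleftrightarrow> (\<exists>G'. clique_chordal_supergraph (k + 1) G G')"
  proof
    assume "\<exists>M. clique_sum_of M G \<and> (\<forall>H\<in>#M. clique H (pverts H) \<or> treewidth H \<le> k)"
    then obtain M where M: "clique_sum_of M G"
        "\<And>H. H \<in># M \<Longrightarrow> clique H (pverts H) \<or> treewidth H \<le> k" by blast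
    show "\<exists>G'. clique_chordal_supergraph (k + 1) G G'"
    proof (rule clique_sum_of_imp_clique_chordal_supergraph[OF M(1)])
      fix H assume H: "H \<in># M" "pair_graph H"
      from M(2)[OF H(1)] show "\<exists>H'. clique_chordal_supergraph (k + 1) H H'"
        using clique_chordal_supergraph_of_clique[OF H(2)]
          clique_chordal_supergraph_if_treewidth_le[OF H(2)] by blast
    qed
  qed (use clique_sum_of_if_clique_chordal_supergraph[OF assms(2)] in blast)
  finally show ?thesis using blended by blast
qed

end
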